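(* Let $F : [0,\infty) \to [0,\infty)$, and let $C_F$ be the composition transform $\Lambda \mapsto F \circ \Lambda$. (1) $C_F$ preserves the class of one-sided Pólya frequency functions if and only if there exists $c > 0$ such that $F(x) = cx$ for all $x$. (2) $C_F$ preserves the class of one-sided Pólya frequency sequences if and only if $F \equiv 0$ or there exists $c > 0$ such that $F(x) = cx$ for all $x$. (3) $C_F$ preserves the class of one-sided totally non-negative functions $\mathbb{R} \to \mathbb{R}$ if and only if $F \equiv 0$ or there exists $c > 0$ such that either $F(x) = cx$ for all $x$ or $F(x) = c\,\mathbf{1}_{x > 0}$ for all $x$.
   Context: A function $\Lambda : \mathbb{R} \to \mathbb{R}$ is totally non-negative if for every $n \geq 1$ and all reals $x_1 < \cdots < x_n$, $y_1 < \cdots < y_n$ one has $\det(\Lambda(x_i - y_j))_{i,j=1}^n \geq 0$ (in particular $\Lambda \geq 0$). A Pólya frequency function is a totally non-negative function $\mathbb{R}\to\mathbb{R}$ that is Lebesgue integrable and non-zero at two or more points. A Pólya frequency sequence is a function $\Lambda : \mathbb{Z} \to \mathbb{R}$ such that the same determinants are non-negative for all integers $x_1 < \cdots < x_n$, $y_1 < \cdots < y_n$ and all $n \geq 1$. For $X \subset \mathbb{R}$ (here $X = \mathbb{R}$ or $X = \mathbb{Z}$), a function $\Lambda : X \to \mathbb{R}$ is one-sided if there exists $x_0 \in \mathbb{R}$ such that $\Lambda \equiv 0$ on $X \cap (-\infty, x_0)$ or $\Lambda \equiv 0$ on $X \cap (x_0, \infty)$. $C_F$ preserves a class if $F \circ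 \Lambda$ belongs to the class for every $\Lambda$ in the class. $\mathbf{1}_{x>0}$ equals $1$ if $x > 0$ and $0$ if $x = 0$. *)

theory Defs
  imports "HOL-Analysis.Analysis" "Jordan_Normal_Form.Determinant"
begin

(* Used with 'a = real and 'a = int.  The determinant is the one of Jordan_Normal_Form,
   whose matrices have a term-level size n (indices 0, ..., n - 1). *)
definition totally_nonneg :: "('a::linordered_idom \<Rightarrow> real) \<Rightarrow> bool" where
  "totally_nonneg \<Lambda> \<longleftrightarrow>
    (\<forall>n\<ge>1. \<forall>x y :: nat \<Rightarrow> 'a.
      strict_mono_on {..<n} x \<longrightarrow> strict_mono_on {..<n} y \<longrightarrow>
      Determinant.det (mat n n (\<lambda>(i, j). \<Lambda> (x i - y j))) \<ge> 0)"

definition polya_frequency_function :: "(real \<Rightarrow> real) \<Rightarrow> bool" where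
  "polya_frequency_function \<Lambda> \<longleftrightarrow>
    totally_nonneg \<Lambda> \<and> integrable lebesgue \<Lambda> \<and>
    (\<exists>x y. x \<noteq> y \<and> \<Lambda> x \<noteq> 0 \<and> \<Lambda> y \<noteq> 0)"

definition polya_frequency_sequence :: "(int \<Rightarrow> real) \<Rightarrow> bool" where
  "polya_frequency_sequence \<Lambda> \<longleftrightarrow> totally_nonneg \<Lambda>"

definition one_sided_function :: "(real \<Rightarrow> real) \<Rightarrow> bool" where
  "one_sided_function \<Lambda> \<longleftrightarrow>
    (\<exists>x0::real. (\<forall>x<x0. \<Lambda> x = 0) \<or> (\<forall>x>x0. \<Lambda> x = 0))"

definition one_sided_sequence :: "(int \<Rightarrow> real) \<Rightarrow> bool" where
  "one_sided_sequence \<Lambda> \<longleftrightarrow>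
    (\<exists>x0::real. (\<forall>k. real_of_int k < x0 \<longrightarrow> \<Lambda> k = 0) \<or>
                (\<forall>k. real_of_int k > x0 \<longrightarrow> \<Lambda> k = 0))"

(* A map F : [0, infinity) -> [0, infinity) is represented by a total function on the reals.
   All classes considered consist of non-negative functions (the case n = 1 of
   totally_nonneg), so only the values of F on [0, infinity) enter here. *)
definition comp_preserves :: "(real \<Rightarrow> real) \<Rightarrow> ('a \<Rightarrow> real) set \<Rightarrow> bool" where
  "comp_preserves F C \<longleftrightarrow> (\<forall>\<Lambda>\<in>C. F \<circ> \<Lambda> \<in> C)"

end

theory Submission
  imports Defs "HOL-Real_Asymp.Real_Asymp" "HOL-Computational_Algebra.Fundamental_Theorem_Algebra"
begin

text \<open>
  Sampling \<open>F \<circ> \<Lambda>\<close> on arithmetic progressions reduces all three classes to Polya frequency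
  sequences, and three one-sided test functions determine \<open>F\<close>, with \<open>q = exp (- x)\<close> for
  \<open>x \<ge> 0\<close>.  The function \<open>q (1 - q)\<close>, which attains a given value on both sides of a
  larger one, forces \<open>F\<close> to be monotone.  The jump of \<open>q\<close> at the origin forces equality in the
  log-concavity inequality, so \<open>F x = C x\<^sup>\<alpha>\<close> for \<open>x > 0\<close>.  Splitting off the leading
  poles of the generating function of \<open>(1 - q)\<^sup>\<alpha>\<close> leaves a sequence with the sign of
  \<open>\<alpha> (\<alpha> - 1)\<close>, which excludes \<open>0 < \<alpha> < 1\<close>; the same for
  \<open>(1 - 3 q\<^sup>2 + 2 q\<^sup>3)\<^sup>\<alpha>\<close> gives the opposite sign and excludes \<open>\<alpha> > 1\<close>.

  That the indicator of \<open>x > 0\<close> preserves total non-negativity on the real line amounts to the support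
  of \<open>\<Lambda>\<close> being empty, a point, or unbounded.  If it were a bounded interval, the
  polynomials with coefficients sampled from \<open>\<Lambda>\<close> on fine grids would have only negative real
  roots, because the Toeplitz matrices are variation diminishing, and then the sampled
  distribution would have too small a variance.
\<close>

section \<open>Determinants and totally non-negative functions\<close>

text \<open>\<open>F\<close> is an arbitrary map, so until monotonicity is known only inequalities
  on grids are available; this is why the power law comes from a monotone Cauchy equation.

  The two exclusions of exponents differ by a parity. With \<open>q = 2 ^ (- n)\<close>, splitting
  off the pole of a term \<open>q ^ m\<close> multiplies the coefficient of \<open>q ^ k\<close> by
  \<open>1 - 2 ^ (k - m)\<close>, which is negative for \<open>k > m\<close>. For
  \<open>1 - q\<close> two poles, of the exponents 0 and 1, precede the first term with the factor
  \<open>\<alpha> * (\<alpha> - 1)\<close>. For \<open>1 - 3 * q ^ 2 + 2 * q ^ 3\<close>, which has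
  no linear term, there are three, of the exponents 0, 2 and 3. An odd number of splittings reverses
  the sign.

  Maps that are constant on \<open>x > 0\<close> separate the classes. They destroy integrability.
  On the integers they turn \<open>1, 2, 1\<close> into \<open>c, c, c\<close>, whose polynomial has
  non-real roots. On the real line a bounded support of positive length does not occur, so this
  obstruction disappears.\<close>

definition ddet :: "nat \<Rightarrow> (nat \<Rightarrow> nat \<Rightarrow> real) \<Rightarrow> real" where
  "ddet n K = Determinant.det (mat n n (\<lambda>(i, j). K i j))"

lemma ddet_cong:
  assumes "\<And>i j. i < n \<Longrightarrow> j < n \<Longrightarrow> K i j = L i j"
  shows "ddet n K = ddet n L"
proof -
  have "mat n n (\<lambda>(i, j). K i j) = mat n n (\<lambda>(i, j). L i j)"
    by (rule eq_matI) (auto simp: assms)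
  then show ?thesis by (simp add: ddet_def)
qed

lemma ddet_0 [simp]: "ddet 0 K = 1"
  by (simp add: ddet_def det_def)

lemma insert_index_less: "i < Suc n \<Longrightarrow> a < n \<Longrightarrow> insert_index i a < Suc n"
  by (auto simp: insert_index_def)

lemma insert_index_strict_mono: "strict_mono (insert_index i)"
  by (auto simp: strict_mono_def insert_index_def)

lemma mat_delete_mat:
  assumes "i < Suc n" "k < Suc n"
  shows "mat_delete (mat (Suc n) (Suc n) (\<lambda>(i, j). K i j)) i k =
    mat n n (\<lambda>(a, b). K (insert_index i a) (insert_index k b))"
  using assms by (intro eq_matI) (auto simp: mat_delete_def insert_index_def)

lemma ddet_col:
  assumes "k < Suc n"
  shows "ddet (Suc n) K =
    (\<Sum>i<Suc n. K i k * ((-1) ^ (i + k) * ddet n (\<lambda>a b. K (insert_index i a) (insert_index k b))))"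
proof -
  let ?A = "mat (Suc n) (Suc n) (\<lambda>(i, j). K i j)"
  have "Determinant.det ?A = (\<Sum>i<Suc n. ?A $$ (i, k) * cofactor ?A i k)"
    by (rule laplace_expansion_column) (use assms in auto)
  also have "\<dots> = (\<Sum>i<Suc n. K i k * ((-1) ^ (i + k) * ddet n (\<lambda>a b. K (insert_index i a) (insert_index k b))))"
    using assms by (intro sum.cong refl) (auto simp: cofactor_def mat_delete_mat ddet_def)
  finally show ?thesis by (simp add: ddet_def)
qed

lemma ddet_transpose: "ddet n (\<lambda>i j. K j i) = ddet n K"
proof -
  have "mat n n (\<lambda>(i, j). K j i) = transpose_mat (mat n n (\<lambda>(i, j). K i j))"
    by (rule eq_matI) auto
  then show ?thesis by (simp add: ddet_def det_transpose[of _ n])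
qed

lemma ddet_row:
  assumes "k < Suc n"
  shows "ddet (Suc n) K =
    (\<Sum>j<Suc n. K k j * ((-1) ^ (k + j) * ddet n (\<lambda>a b. K (insert_index k a) (insert_index j b))))"
  by (subst ddet_transpose[symmetric], subst ddet_col[OF assms],
      subst (2) ddet_transpose[symmetric]) (simp add: add.commute)

lemma ddet_equal_rows:
  assumes "i < n" "j < n" "i \<noteq> j" "\<And>l. l < n \<Longrightarrow> K i l = K j l"
  shows "ddet n K = 0"
  unfolding ddet_def
  by (rule det_identical_rows[of _ n i j]) (use assms in \<open>auto intro!: eq_vecI\<close>)

lemma ddet_equal_cols:
  assumes "i < n" "j < n" "i \<noteq> j" "\<And>l. l < n \<Longrightarrow> K l i = K l j"
  shows "ddet n K = 0"
  by (subst ddet_transpose[symmetric], rule ddet_equal_rows[of i n j]) (use assms in auto)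

lemma ddet_scale: "ddet n (\<lambda>i j. u i * v j * K i j) = (\<Prod>i<n. u i) * (\<Prod>j<n. v j) * ddet n K"
proof -
  have *: "(\<Prod>i = 0..<n. u i * (v (p i) * K i (p i))) =
      (\<Prod>i<n. u i) * ((\<Prod>j<n. v j) * (\<Prod>i = 0..<n. K i (p i)))" if p: "p permutes {0..<n}" for p
    using prod.permute[OF p, of v] by (simp add: prod.distrib atLeast0LessThan o_def)
  have pl: "p i < n" if "p permutes {0..<n}" "i < n" for p i
    using permutes_in_image[OF that(1)] that(2) by auto
  show ?thesis
    unfolding ddet_def det_def'[OF mat_carrier]
    by (simp add: sum_distrib_left pl mult.assoc cong: prod.cong)
       (intro sum.cong refl, simp add: * mult_ac)
qed

lemma ddet_mult:
  "ddet n (\<lambda>i j. \<Sum>k<n. P i k * K k j) = ddet n P * ddet n K"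
proof -
  have "mat n n (\<lambda>(i, j). \<Sum>k<n. P i k * K k j) = mat n n (\<lambda>(i, j). P i j) * mat n n (\<lambda>(i, j). K i j)"
    by (rule eq_matI) (auto simp: scalar_prod_def atLeast0LessThan)
  then show ?thesis by (simp add: ddet_def det_mult[where n = n])
qed

text \<open>Every row is differenced against the original previous row: this is left multiplication
  by the unit lower bidiagonal matrix \<open>P\<close>. The coefficient \<open>c\<close> is 1 for
  primitives and the ratio of a pole for pole splitting.\<close>

lemma ddet_row_differences:
  "ddet n (\<lambda>i j. K i j - (if i = 0 then 0 else c * K (i - 1) j)) = ddet n K"
proof -
  define P :: "nat \<Rightarrow> nat \<Rightarrow> real" where "P i k = (if k = i then 1 else if Suc k = i then - c else 0)" for i k
  have "ddet n P = prod_list (diag_mat (mat n n (\<lambda>(i, j). P i j)))"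
    unfolding ddet_def by (rule det_lower_triangular[where n = n]) (auto simp: P_def)
  also have "diag_mat (mat n n (\<lambda>(i, j). P i j)) = replicate n 1"
    by (auto simp: diag_mat_def P_def intro!: nth_equalityI)
  finally have P: "ddet n P = 1" by simp
  have "ddet n (\<lambda>i j. \<Sum>k<n. P i k * K k j) = ddet n K"
    by (simp add: ddet_mult P)
  moreover have "(\<Sum>k<n. P i k * K k j) = K i j - (if i = 0 then 0 else c * K (i - 1) j)" if "i < n" for i j
  proof (cases i)
    case 0
    have "(\<Sum>k<n. P i k * K k j) = (\<Sum>k\<in>{0}. P i k * K k j)"
      using that 0 by (intro sum.mono_neutral_right) (auto simp: P_def)
    then show ?thesis using 0 by (simp add: P_def)
  next
    case (Suc l)
    have "(\<Sum>k<n. P i k * K k j) = (\<Sum>k\<in>{l, Suc l}. P i k * K k j)"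
      using that Suc by (intro sum.mono_neutral_right) (auto simp: P_def)
    then show ?thesis using Suc by (simp add: P_def)
  qed
  ultimately show ?thesis by (metis (no_types, lifting) ddet_cong)
qed

lemma ddet_eq_0_iff:
  "ddet n K = 0 \<longleftrightarrow> (\<exists>v. (\<exists>j<n. v j \<noteq> 0) \<and> (\<forall>i<n. (\<Sum>j<n. K i j * v j) = 0))"
proof -
  let ?A = "mat n n (\<lambda>(i, j). K i j)"
  have A: "?A \<in> carrier_mat n n" by simp
  have *: "?A *\<^sub>v v = 0\<^sub>v n \<longleftrightarrow> (\<forall>i<n. (\<Sum>j<n. K i j * v $ j) = 0)" if "v \<in> carrier_vec n" for v
    using that by (auto simp: vec_eq_iff scalar_prod_def atLeast0LessThan)
  have **: "v = 0\<^sub>v n \<longleftrightarrow> (\<forall>j<n. v $ j = 0)" if "v \<in> carrier_vec n" for v :: "real Matrix.vec"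
    using that by (auto simp: vec_eq_iff)
  show ?thesis
    unfolding ddet_def det_0_iff_vec_prod_zero[OF A]
  proof (intro iffI; elim exE conjE)
    fix v assume "v \<in> carrier_vec n" "v \<noteq> 0\<^sub>v n" "?A *\<^sub>v v = 0\<^sub>v n"
    then show "\<exists>v. (\<exists>j<n. v j \<noteq> 0) \<and> (\<forall>i<n. (\<Sum>j<n. K i j * v j) = 0)"
      using * ** by (intro exI[of _ "\<lambda>j. v $ j"]) auto
  next
    fix v j assume "\<forall>i<n. (\<Sum>j<n. K i j * v j) = 0" "j < n" "v j \<noteq> (0::real)"
    then show "\<exists>v. v \<in> carrier_vec n \<and> v \<noteq> 0\<^sub>v n \<and> ?A *\<^sub>v v = 0\<^sub>v n"
      using *[OF vec_carrier, of v] **[OF vec_carrier, of v] by (intro exI[of _ "vec n v"]) auto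
  qed
qed

lemma ddet_replace_col:
  assumes "k < n"
  shows "ddet n (\<lambda>i j. if j = k then (\<Sum>l<n. K i l * x l) else K i j) = x k * ddet n K"
proof -
  let ?A = "mat n n (\<lambda>(i, j). K i j)"
  have "replace_col ?A (?A *\<^sub>v vec n x) k = mat n n (\<lambda>(i, j). if j = k then (\<Sum>l<n. K i l * x l) else K i j)"
    by (rule eq_matI) (auto simp: replace_col_def scalar_prod_def atLeast0LessThan)
  with cramer_lemma_mat[of ?A n "vec n x" k] assms show ?thesis by (simp add: ddet_def)
qed

section \<open>Basic closure properties of total non-negativity\<close>

lemma totally_nonneg_iff:
  "totally_nonneg \<Lambda> \<longleftrightarrow> (\<forall>n x y. strict_mono_on {..<n} x \<longrightarrow> strict_mono_on {..<n} y \<longrightarrow>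
    ddet n (\<lambda>i j. \<Lambda> (x i - y j)) \<ge> 0)"
proof -
  have "n \<ge> 1 \<or> ddet n K \<ge> 0" for n K by (cases n) auto
  then show ?thesis unfolding totally_nonneg_def ddet_def[symmetric] by blast
qed

lemma totally_nonnegD:
  assumes "totally_nonneg \<Lambda>" "strict_mono_on {..<n} x" "strict_mono_on {..<n} y"
  shows "ddet n (\<lambda>i j. \<Lambda> (x i - y j)) \<ge> 0"
  using assms by (simp add: totally_nonneg_iff)

lemma ddet_1: "ddet 1 K = K 0 0" "ddet (Suc 0) K = K 0 0"
  using ddet_col[of 0 0 K] by (auto simp: insert_index_def)

lemma ddet_2: "ddet 2 K = K 0 0 * K 1 1 - K 0 1 * K 1 0"
  using ddet_col[of 0 1 K] by (simp add: ddet_1 insert_index_def numeral_2_eq_2)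

lemma ddet_3: "ddet 3 K = K 0 0 * (K 1 1 * K 2 2 - K 1 2 * K 2 1) - K 1 0 * (K 0 1 * K 2 2 - K 0 2 * K 2 1)
   + K 2 0 * (K 0 1 * K 1 2 - K 0 2 * K 1 1)"
  using ddet_col[of 0 2 K] ddet_2
  by (simp add: insert_index_def numeral_3_eq_3 numeral_2_eq_2)

lemma totally_nonneg_nonneg:
  fixes \<Lambda> :: "'a :: linordered_idom \<Rightarrow> real"
  assumes "totally_nonneg \<Lambda>"
  shows "\<Lambda> z \<ge> 0"
proof -
  have "strict_mono_on {..<1::nat} x" for x :: "nat \<Rightarrow> 'a"
    by (rule strict_mono_onI) auto
  then show ?thesis
    using totally_nonnegD[OF assms, of 1 "\<lambda>_. z" "\<lambda>_. 0"] by (simp add: ddet_1)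
qed

text \<open>Rows \<open>p < s\<close> and columns \<open>p - r < 0\<close> put
  \<open>\<Lambda> r\<close> and \<open>\<Lambda> s\<close> on the diagonal and
  \<open>\<Lambda> p\<close> and \<open>\<Lambda> q\<close> off it. This is log-concavity.\<close>

lemma totally_nonneg_2x2:
  assumes "totally_nonneg \<Lambda>" "p < r" "p < s" "r + s = p + q"
  shows "\<Lambda> p * \<Lambda> q \<le> \<Lambda> r * \<Lambda> s"
proof -
  have "ddet 2 (\<lambda>i j. \<Lambda> ((if i = 0 then p else s) - (if j = 0 then p - r else 0))) \<ge> 0"
    by (rule totally_nonnegD) (use assms in \<open>auto simp: strict_mono_on_def\<close>)
  moreover have "s + r - p = q" using assms(4) by (simp add: algebra_simps)
  ultimately show ?thesis by (simp add: ddet_2 algebra_simps)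
qed

lemma totally_nonneg_factor:
  assumes "totally_nonneg \<Lambda>" "\<And>x. u x \<ge> 0" "\<And>x. v x \<ge> 0" "\<And>x y. M (x - y) = u x * v y * \<Lambda> (x - y)"
  shows "totally_nonneg (M :: 'a :: linordered_idom \<Rightarrow> real)"
  unfolding totally_nonneg_iff
proof (intro allI impI)
  fix n :: nat and x y :: "nat \<Rightarrow> 'a" assume "strict_mono_on {..<n} x" "strict_mono_on {..<n} y"
  then show "ddet n (\<lambda>i j. M (x i - y j)) \<ge> 0"
    using totally_nonnegD[OF assms(1), of n x y] assms(2,3)
    by (simp add: assms(4) ddet_scale[of n "\<lambda>i. u (x i)" "\<lambda>j. v (y j)" "\<lambda>i j. \<Lambda> (x i - y j)"] prod_nonneg)
qed

lemma totally_nonneg_cmult: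
  assumes "totally_nonneg \<Lambda>" "c \<ge> 0"
  shows "totally_nonneg (\<lambda>x. c * \<Lambda> x)"
  by (rule totally_nonneg_factor[OF assms(1), of "\<lambda>_. c" "\<lambda>_. 1"]) (use assms in auto)

lemma totally_nonneg_reflect:
  fixes \<Lambda> :: "'a :: linordered_idom \<Rightarrow> real"
  assumes "totally_nonneg \<Lambda>"
  shows "totally_nonneg (\<lambda>x. \<Lambda> (- x))"
  unfolding totally_nonneg_iff
proof (intro allI impI)
  fix n :: nat and x y :: "nat \<Rightarrow> 'a" assume "strict_mono_on {..<n} x" "strict_mono_on {..<n} y"
  then show "ddet n (\<lambda>i j. \<Lambda> (- (x i - y j))) \<ge> 0"
    using totally_nonnegD[OF assms, of n y x] by (subst ddet_transpose[symmetric]) simp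
qed

lemma totally_nonneg_affine:
  fixes \<Lambda> :: "real \<Rightarrow> real"
  assumes "totally_nonneg \<Lambda>" "h > 0"
  shows "totally_nonneg (\<lambda>x. \<Lambda> (h * x + s))"
  unfolding totally_nonneg_iff
proof (intro allI impI)
  fix n :: nat and x y :: "nat \<Rightarrow> real" assume "strict_mono_on {..<n} x" "strict_mono_on {..<n} y"
  then show "ddet n (\<lambda>i j. \<Lambda> (h * (x i - y j) + s)) \<ge> 0"
    using totally_nonnegD[OF assms(1), of n "\<lambda>i. h * x i + s" "\<lambda>j. h * y j"] \<open>h > 0\<close>
    by (auto simp: strict_mono_on_def algebra_simps)
qed

lemma totally_nonneg_sample:
  fixes \<Lambda> :: "real \<Rightarrow> real"
  assumes "totally_nonneg \<Lambda>"
  shows "totally_nonneg (\<lambda>k. \<Lambda> (real_of_int k))"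
  unfolding totally_nonneg_iff
proof (intro allI impI)
  fix n and x y :: "nat \<Rightarrow> int" assume "strict_mono_on {..<n} x" "strict_mono_on {..<n} y"
  then show "ddet n (\<lambda>i j. \<Lambda> (real_of_int (x i - y j))) \<ge> 0"
    using totally_nonnegD[OF assms, of n "\<lambda>i. real_of_int (x i)" "\<lambda>j. real_of_int (y j)"]
    by (auto simp: strict_mono_on_def)
qed


section \<open>Determinants with rows averaged over weakly increasing choices\<close>

lemma totally_nonneg_weak_mono_rows:
  assumes "totally_nonneg \<Lambda>" "mono_on {..<n} x" "strict_mono_on {..<n} y"
  shows "ddet n (\<lambda>i j. \<Lambda> (x i - y j)) \<ge> 0"
proof (cases "strict_mono_on {..<n} x")
  case True
  with assms show ?thesis by (intro totally_nonnegD)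
next
  case False
  then obtain i j where ij: "i < n" "j < n" "i < j" "\<not> x i < x j"
    by (auto simp: strict_mono_on_def)
  with assms(2) have "x i = x j"
    by (meson antisym_conv2 lessThan_iff less_imp_le mono_onD)
  with ij show ?thesis by (subst ddet_equal_rows[of i n j]) auto
qed

text \<open>The determinant is linear in each row, so rows can be replaced one at a time. That
  \<open>G i\<close> is a positive sum or an integral of rows \<open>f s\<close> with
  \<open>s \<in> T i\<close> is expressed dually, by linear functionals \<open>c\<close>, of which
  the cofactor vector is the one that matters. One statement thus covers finite sums and
  integrals.\<close>

lemma ddet_nonneg_cone_rows:
  fixes f :: "'t \<Rightarrow> nat \<Rightarrow> real"
  assumes base: "\<And>t. (\<And>i. i < n \<Longrightarrow> t i \<in> T i) \<Longrightarrow> ddet n (\<lambda>i j. f (t i) j) \<ge> 0"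
    and cone: "\<And>i c. i < n \<Longrightarrow> (\<And>s. s \<in> T i \<Longrightarrow> 0 \<le> (\<Sum>j<n. f s j * c j)) \<Longrightarrow>
      0 \<le> (\<Sum>j<n. G i j * c j)"
  shows "ddet n G \<ge> 0"
proof -
  have "ddet n (\<lambda>i j. if i < k then G i j else f (t i) j) \<ge> 0"
    if "k \<le> n" "\<And>i. k \<le> i \<Longrightarrow> i < n \<Longrightarrow> t i \<in> T i" for k t
    using that
  proof (induction k arbitrary: t)
    case 0
    then show ?case using base[of t] by simp
  next
    case (Suc k)
    then obtain m where n: "n = Suc m" by (cases n) auto
    define L where "L r i j = (if i < k then G i j else if i = k then r j else f (t i) j)" for r i j
    define C where "C j = (-1) ^ (k + j) * ddet m (\<lambda>a b. L (\<lambda>_. 0) (insert_index k a) (insert_index j b))" for j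
    have expand: "ddet n (L r) = (\<Sum>j<n. r j * C j)" for r
    proof -
      have "ddet m (\<lambda>a b. L r (insert_index k a) (insert_index j b)) =
          ddet m (\<lambda>a b. L (\<lambda>_. 0) (insert_index k a) (insert_index j b))" for j
        by (rule ddet_cong) (auto simp: L_def insert_index_def)
      then show ?thesis
        using Suc.prems by (simp add: n ddet_row[of k] C_def) (simp add: L_def)
    qed
    have "0 \<le> (\<Sum>j<n. f s j * C j)" if "s \<in> T k" for s
    proof -
      have "ddet n (\<lambda>i j. if i < k then G i j else f ((t(k := s)) i) j) \<ge> 0"
        using Suc.prems that by (intro Suc.IH) auto
      also have "ddet n (\<lambda>i j. if i < k then G i j else f ((t(k := s)) i) j) = ddet n (L (f s))"
        by (rule ddet_cong) (auto simp: L_def)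
      finally show ?thesis by (simp add: expand)
    qed
    then have "0 \<le> ddet n (L (G k))"
      using Suc.prems by (simp add: expand cone)
    also have "ddet n (L (G k)) = ddet n (\<lambda>i j. if i < Suc k then G i j else f (t i) j)"
      by (rule ddet_cong) (auto simp: L_def less_Suc_eq)
    finally show ?case .
  qed
  from this[of n undefined] have "ddet n (\<lambda>i j. if i < n then G i j else f (undefined i) j) \<ge> 0" by simp
  also have "ddet n (\<lambda>i j. if i < n then G i j else f (undefined i) j) = ddet n G"
    by (rule ddet_cong) auto
  finally show ?thesis .
qed

text \<open>Differencing consecutive rows turns the entries of \<open>g\<close> into integrals of
  \<open>f\<close> over the adjacent intervals from \<open>x (i - 1)\<close> to \<open>x i\<close>.
  Points chosen from adjacent intervals are weakly increasing, and coinciding rows only make the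
  determinant zero.\<close>

lemma totally_nonneg_primitive:
  fixes f g :: "real \<Rightarrow> real"
  assumes f: "totally_nonneg f"
    and g: "\<And>x y. x \<le> y \<Longrightarrow> (f has_integral (g y - g x)) {x..y}"
    and g0: "\<And>x. x < 0 \<Longrightarrow> g x = 0"
  shows "totally_nonneg g"
  unfolding totally_nonneg_iff
proof (intro allI impI)
  fix n and x y :: "nat \<Rightarrow> real"
  assume x: "strict_mono_on {..<n} x" and y: "strict_mono_on {..<n} y"
  \<comment> \<open>An artificial left end for the first interval, below every \<open>y j\<close>,
    so that \<open>g (z - y j) = 0\<close>. The inserted 0 keeps the set non-empty when
    \<open>n = 0\<close>.\<close>
  define z where "z = Min (insert 0 (x ` {..<n} \<union> y ` {..<n})) - 1"
  have z: "z < x i" "z < y i" if "i < n" for i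
  proof -
    have "z + 1 \<le> x i" "z + 1 \<le> y i" unfolding z_def using that by (auto intro!: Min_le)
    then show "z < x i" "z < y i" by linarith+
  qed
  define l where "l i = (if i = 0 then z else x (i - 1))" for i
  have l: "l i \<le> x i" if "i < n" for i
    using z[OF that] strict_mono_onD[OF x, of "i - 1" i] that by (auto simp: l_def)
  define G where "G i j = g (x i - y j) - (if i = 0 then 0 else 1 * g (x (i - 1) - y j))" for i j
  have G: "G i j = g (x i - y j) - g (l i - y j)" if "j < n" for i j
    using z[OF that] g0[of "z - y j"] by (auto simp: G_def l_def)
  have "ddet n G \<ge> 0"
  proof (rule ddet_nonneg_cone_rows[where f = "\<lambda>t j. f (t - y j)" and T = "\<lambda>i. {l i..x i}"])
    fix t assume t: "\<And>i. i < n \<Longrightarrow> t i \<in> {l i..x i}"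
    have "t i \<le> t j" if "i < j" "j < n" for i j
    proof -
      have "t i \<le> x i" using t[of i] that by auto
      also have "x i \<le> x (j - 1)"
        using strict_mono_onD[OF x, of i "j - 1"] that by (cases "i = j - 1") force+
      also have "\<dots> \<le> t j" using t[of j] that by (auto simp: l_def)
      finally show ?thesis .
    qed
    then have "mono_on {..<n} t"
      by (intro mono_onI) (metis le_less lessThan_iff order_refl)
    then show "ddet n (\<lambda>i j. f (t i - y j)) \<ge> 0"
      by (intro totally_nonneg_weak_mono_rows f y)
  next
    fix i c assume i: "i < n" and c: "\<And>s. s \<in> {l i..x i} \<Longrightarrow> 0 \<le> (\<Sum>j<n. f (s - y j) * c j)"
    have "((\<lambda>s. f (s - y j)) has_integral (g (x i - y j) - g (l i - y j))) {l i..x i}" for j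
      using has_integral_affinity[where m = 1 and c = "- y j" and a = "l i - y j" and b = "x i - y j" and
          f = f and i = "g (x i - y j) - g (l i - y j)"] g[of "l i - y j" "x i - y j"] l[OF i]
      by (simp add: image_iff)
    then have "((\<lambda>s. \<Sum>j<n. f (s - y j) * c j) has_integral (\<Sum>j<n. (g (x i - y j) - g (l i - y j)) * c j)) {l i..x i}"
      by (intro has_integral_sum has_integral_mult_left) auto
    with c have "0 \<le> (\<Sum>j<n. (g (x i - y j) - g (l i - y j)) * c j)"
      by (meson has_integral_nonneg)
    then show "0 \<le> (\<Sum>j<n. G i j * c j)" by (simp add: G)
  qed
  then show "0 \<le> ddet n (\<lambda>i j. g (x i - y j))"
    using ddet_row_differences[of n "\<lambda>i j. g (x i - y j)" 1] by (simp add: G_def[abs_def])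
qed

text \<open>The generating function is multiplied by \<open>1 + t\<close>. Choices from the pairs
  \<open>{x i - 1, x i}\<close> are weakly increasing because the \<open>x i\<close> are strictly
  increasing integers.\<close>

lemma totally_nonneg_add_shift:
  fixes a :: "int \<Rightarrow> real"
  assumes "totally_nonneg a"
  shows "totally_nonneg (\<lambda>k. a k + a (k - 1))"
  unfolding totally_nonneg_iff
proof (intro allI impI)
  fix n and x y :: "nat \<Rightarrow> int"
  assume x: "strict_mono_on {..<n} x" and y: "strict_mono_on {..<n} y"
  show "ddet n (\<lambda>i j. a (x i - y j) + a (x i - y j - 1)) \<ge> 0"
  proof (rule ddet_nonneg_cone_rows[where f = "\<lambda>t j. a (t - y j)" and T = "\<lambda>i. {x i - 1, x i}"])
    fix t assume t: "\<And>i. i < n \<Longrightarrow> t i \<in> {x i - 1, x i}"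
    have "t i \<le> t j" if "i < j" "j < n" for i j
      using t[of i] t[of j] strict_mono_onD[OF x, of i j] that by auto
    then have "mono_on {..<n} t"
      by (intro mono_onI) (metis le_less lessThan_iff order_refl)
    then show "ddet n (\<lambda>i j. a (t i - y j)) \<ge> 0"
      by (intro totally_nonneg_weak_mono_rows assms y)
  next
    fix i c assume c: "\<And>s. s \<in> {x i - 1, x i} \<Longrightarrow> 0 \<le> (\<Sum>j<n. a (s - y j) * c j)"
    show "0 \<le> (\<Sum>j<n. (a (x i - y j) + a (x i - y j - 1)) * c j)"
      using c[of "x i - 1"] c[of "x i"]
      by (simp add: distrib_right sum.distrib algebra_simps)
  qed
qed

section \<open>Indicators of half-lines and points\<close>

lemma ddet_first_row:
  assumes "\<And>j. 0 < j \<Longrightarrow> j < Suc n \<Longrightarrow> K 0 j = 0"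
  shows "ddet (Suc n) K = K 0 0 * ddet n (\<lambda>a b. K (Suc a) (Suc b))"
proof -
  have "ddet (Suc n) K = (\<Sum>j\<in>{0}. K 0 j * ((-1) ^ (0 + j) *
      ddet n (\<lambda>a b. K (insert_index 0 a) (insert_index j b))))"
    unfolding ddet_row[OF zero_less_Suc]
    by (rule sum.mono_neutral_right) (use assms in auto)
  then show ?thesis by (simp add: insert_index_def)
qed

lemma ddet_first_col:
  assumes "\<And>i. 0 < i \<Longrightarrow> i < Suc n \<Longrightarrow> K i 0 = 0"
  shows "ddet (Suc n) K = K 0 0 * ddet n (\<lambda>a b. K (Suc a) (Suc b))"
  by (subst (1 2) ddet_transpose[symmetric], subst ddet_first_row) (use assms in auto)

lemma strict_mono_on_Suc:
  "strict_mono_on {..<Suc n} x \<Longrightarrow> strict_mono_on {..<n} (\<lambda>i. x (Suc i))"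
  by (auto simp: strict_mono_on_def)

text \<open>The first row decides. If it is supported on the first column, expansion reduces the
  size; otherwise \<open>x 0 - y 1\<close> lies in \<open>U\<close> and the first two columns
  consist of ones only.\<close>

lemma totally_nonneg_indicator_upper:
  fixes U :: "'a :: linordered_idom set"
  assumes U: "\<And>x y. x \<in> U \<Longrightarrow> x \<le> y \<Longrightarrow> y \<in> U"
  shows "totally_nonneg (indicator U :: 'a \<Rightarrow> real)"
  unfolding totally_nonneg_iff
proof (intro allI impI)
  fix n and x y :: "nat \<Rightarrow> 'a"
  assume "strict_mono_on {..<n} x" "strict_mono_on {..<n} y"
  then show "ddet n (\<lambda>i j. indicator U (x i - y j)) \<ge> 0"
  proof (induction n arbitrary: x y)
    case (Suc n)
    note xy = strict_mono_onD[OF Suc.prems(1)] strict_mono_onD[OF Suc.prems(2)]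
    have IH: "ddet n (\<lambda>a b. indicator U (x (Suc a) - y (Suc b))) \<ge> 0"
      by (rule Suc.IH) (use Suc.prems in \<open>auto intro: strict_mono_on_Suc\<close>)
    have yj: "x 0 - y j < x 0 - y 0" if "0 < j" "j < Suc n" for j
      using xy(2)[of 0 j] that by auto
    have col: "x i - y j \<in> U" if "x 0 - y j \<in> U" "i < Suc n" for i j
    proof (cases "i = 0")
      case False
      then have "x 0 < x i" using xy(1)[of 0 i] that by auto
      then show ?thesis by (intro U[OF that(1)]) auto
    qed (use that in auto)
    show ?case
    proof (cases "n \<ge> 1 \<and> x 0 - y 1 \<in> U")
      case True
      then have "x 0 - y 0 \<in> U" using yj[of 1] by (auto intro: less_imp_le U[of "x 0 - y 1"])
      then show ?thesis using True
        by (subst ddet_equal_cols[of 0 _ 1]) (auto simp: col)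
    next
      case False
      have "x 0 - y j \<notin> U" if "0 < j" "j < Suc n" for j
      proof
        assume "x 0 - y j \<in> U"
        moreover have "y 1 \<le> y j" using xy(2)[of 1 j] that by (cases "j = 1") auto
        ultimately have "x 0 - y 1 \<in> U" by (auto elim: U)
        with False that show False by auto
      qed
      then show ?thesis using IH
        by (subst ddet_first_row) (auto split: split_indicator)
    qed
  qed auto
qed

text \<open>The argument decreases along the first row and increases down the first column.
  According to the side of \<open>d\<close> on which the corner \<open>x 0 - y 0\<close> lies, the
  rest of the row or of the column vanishes.\<close>

lemma totally_nonneg_indicator_singleton:
  fixes d :: "'a :: linordered_idom"
  shows "totally_nonneg (indicator {d} :: 'a \<Rightarrow> real)"
  unfolding totally_nonneg_iff
proof (intro allI impI)
  fix n and x y :: "nat \<Rightarrow> 'a"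
  assume "strict_mono_on {..<n} x" "strict_mono_on {..<n} y"
  then show "ddet n (\<lambda>i j. indicator {d} (x i - y j)) \<ge> 0"
  proof (induction n arbitrary: x y)
    case (Suc n)
    note xy = strict_mono_onD[OF Suc.prems(1)] strict_mono_onD[OF Suc.prems(2)]
    have IH: "ddet n (\<lambda>a b. indicator {d} (x (Suc a) - y (Suc b))) \<ge> 0"
      by (rule Suc.IH) (use Suc.prems in \<open>auto intro: strict_mono_on_Suc\<close>)
    have yj: "x 0 - y j < x 0 - y 0" if "0 < j" "j < Suc n" for j
      using xy(2)[of 0 j] that by auto
    have xi: "x 0 - y 0 < x i - y 0" if "0 < i" "i < Suc n" for i
      using xy(1)[of 0 i] that by auto
    show ?case
    proof (cases "x 0 - y 0 \<le> d")
      case True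
      then have "x 0 - y j \<noteq> d" if "0 < j" "j < Suc n" for j using yj[OF that] by auto
      then show ?thesis using IH
        by (subst ddet_first_row) (auto split: split_indicator)
    next
      case False
      then have "x i - y 0 \<noteq> d" if "0 < i" "i < Suc n" for i using xi[OF that] by auto
      then show ?thesis using IH
        by (subst ddet_first_col) (auto split: split_indicator)
    qed
  qed auto
qed

section \<open>Variation diminishing kernels\<close>

text \<open>General rectangular kernels are used because the Toeplitz form is lost as soon as a
  column is discarded.\<close>

definition tn_kernel :: "nat \<Rightarrow> nat \<Rightarrow> (nat \<Rightarrow> nat \<Rightarrow> real) \<Rightarrow> bool" where
  "tn_kernel m n K \<longleftrightarrow> (\<forall>k r c. strict_mono_on {..<k} r \<longrightarrow> strict_mono_on {..<k} c \<longrightarrow>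
     r ` {..<k} \<subseteq> {..<m} \<longrightarrow> c ` {..<k} \<subseteq> {..<n} \<longrightarrow> ddet k (\<lambda>i j. K (r i) (c j)) \<ge> 0)"

lemma tn_kernelD:
  assumes "tn_kernel m n K" "strict_mono_on {..<k} r" "strict_mono_on {..<k} c"
    "\<And>i. i < k \<Longrightarrow> r i < m" "\<And>j. j < k \<Longrightarrow> c j < n"
  shows "ddet k (\<lambda>i j. K (r i) (c j)) \<ge> 0"
  using assms unfolding tn_kernel_def by blast

lemma tn_kernel_comp:
  assumes K: "tn_kernel m n K" and f: "strict_mono f" and g: "strict_mono g"
    and fm: "\<And>i. i < m' \<Longrightarrow> f i < m" and gn: "\<And>j. j < n' \<Longrightarrow> g j < n"
  shows "tn_kernel m' n' (\<lambda>i j. K (f i) (g j))"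
  unfolding tn_kernel_def
proof (intro allI impI)
  fix k and r c :: "nat \<Rightarrow> nat" assume "strict_mono_on {..<k} r" "strict_mono_on {..<k} c"
     "r ` {..<k} \<subseteq> {..<m'}" "c ` {..<k} \<subseteq> {..<n'}"
  then show "ddet k (\<lambda>i j. K (f (r i)) (g (c j))) \<ge> 0"
    using f g fm gn
    by (intro tn_kernelD[OF K, of k "\<lambda>i. f (r i)" "\<lambda>j. g (c j)"])
       (auto simp: strict_mono_on_def strict_mono_def image_subset_iff)
qed

lemma insert_index_strict_mono_on: "strict_mono_on A (insert_index i)"
  by (auto simp: strict_mono_on_def insert_index_def)

lemma strict_mono_on_id: "strict_mono_on A (\<lambda>i::nat. i)"
  by (auto simp: strict_mono_on_def)

text \<open>Moving along a kernel vector until the first coordinate vanishes flips no sign,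
  so a column can be discarded.\<close>

lemma drop_column:
  fixes x v :: "nat \<Rightarrow> real"
  assumes v: "\<exists>j<Suc n. v j \<noteq> 0"
    and ker: "\<forall>i<m. (\<Sum>j<Suc n. K i j * v j) = 0"
  shows "\<exists>p x'. p < Suc n \<and>
    (\<forall>i<m. (\<Sum>j<n. K i (insert_index p j) * x' j) = (\<Sum>j<Suc n. K i j * x j)) \<and>
    (\<forall>s j. s \<in> {1, -1} \<longrightarrow> j < n \<longrightarrow> s * x' j > 0 \<longrightarrow> s * x (insert_index p j) > 0)"
proof -
  define S where "S = {j. j < Suc n \<and> v j \<noteq> 0}"
  have S: "finite S" "S \<noteq> {}" using v by (auto simp: S_def)
  \<comment> \<open>The smallest ratio in absolute value cancels the coordinate \<open>p\<close>,
    while \<open>t * v j\<close> exceeds no \<open>x j\<close> in absolute value.\<close>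
  define p where "p = arg_min_on (\<lambda>j. \<bar>x j / v j\<bar>) S"
  have p: "p \<in> S" "\<And>j. j \<in> S \<Longrightarrow> \<bar>x p / v p\<bar> \<le> \<bar>x j / v j\<bar>"
    unfolding p_def using arg_min_if_finite[OF S] arg_min_least[OF S] by auto
  define t where "t = x p / v p"
  define z where "z j = x j - t * v j" for j
  have zp: "z p = 0" using p(1) by (simp add: z_def t_def S_def)
  have bound: "\<bar>t * v j\<bar> \<le> \<bar>x j\<bar>" if "j < Suc n" for j
  proof (cases "v j = 0")
    case False
    then have "\<bar>t\<bar> \<le> \<bar>x j\<bar> / \<bar>v j\<bar>" using p(2)[of j] that by (simp add: S_def t_def)
    then show ?thesis using False by (simp add: abs_mult pos_le_divide_eq)
  qed auto
  have sgn: "s * x j > 0" if "s \<in> {1, -1}" "j < Suc n" "s * z j > 0" for s j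
    using bound[OF that(2)] that by (auto simp: z_def)
  have sum_z: "(\<Sum>j<Suc n. K i j * z j) = (\<Sum>j<Suc n. K i j * x j)" if "i < m" for i
  proof -
    have "(\<Sum>j<Suc n. K i j * z j) = (\<Sum>j<Suc n. K i j * x j) - t * (\<Sum>j<Suc n. K i j * v j)"
      unfolding z_def sum_distrib_left sum_subtractf[symmetric] by (intro sum.cong) (auto simp: algebra_simps)
    then show ?thesis using ker that by simp
  qed
  have pn: "p < Suc n" using p(1) by (simp add: S_def)
  have img: "insert_index p ` {..<n} = {..<Suc n} - {p}"
    using insert_index_image[OF pn] by (simp add: atLeast0LessThan)
  have "(\<Sum>j<n. K i (insert_index p j) * z (insert_index p j)) = (\<Sum>j<Suc n. K i j * x j)" if "i < m" for i
  proof -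
    have "(\<Sum>j<n. K i (insert_index p j) * z (insert_index p j)) = (\<Sum>j\<in>insert_index p ` {..<n}. K i j * z j)"
      by (simp add: sum.reindex insert_index_inj_on)
    also have "\<dots> = (\<Sum>j<Suc n. K i j * z j)"
      unfolding img using zp pn by (intro sum.mono_neutral_left) auto
    finally show ?thesis using sum_z[OF that] by simp
  qed
  moreover have "s * x (insert_index p j) > 0"
    if "s \<in> {1, -1}" "j < n" "s * z (insert_index p j) > 0" for s j
    using that by (intro sgn) (auto intro: insert_index_less[OF pn])
  ultimately show ?thesis
    using pn by (intro exI[of _ p] exI[of _ "\<lambda>j. z (insert_index p j)"]) blast
qed

lemma minor_nonneg:
  assumes K: "tn_kernel m n K" and "k < m" "k < n" "a \<le> k" "b \<le> k"
  shows "ddet k (\<lambda>i j. K (insert_index a i) (insert_index b j)) \<ge> 0"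
  using assms(2-) by (intro tn_kernelD[OF K] insert_index_strict_mono_on) 
    (auto simp: insert_index_def)

text \<open>If the image alternated strictly in \<open>Suc n\<close> places, bordering the kernel
  with it would give a singular matrix whose expansion along the last column has terms of one sign
  only, one of them non-zero. The non-zero term needs a non-singular top block; if that block is
  singular, a column is discarded and the induction hypothesis applies.\<close>

lemma tn_kernel_no_excess_alternation:
  assumes "tn_kernel (Suc n) n K"
  shows "\<exists>i<Suc n. (-1) ^ i * (\<Sum>j<n. K i j * x j) \<le> 0"
  using assms
proof (induction n arbitrary: K x)
  case 0
  show ?case by auto
next
  case (Suc n)
  show ?case
  proof (rule ccontr)
    assume "\<not> ?thesis"
    then have alt: "(-1) ^ i * (\<Sum>j<Suc n. K i j * x j) > 0" if "i < Suc (Suc n)" for i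
      using that by (auto simp: not_le)
    show False
    proof (cases "ddet (Suc n) K = 0")
      case True
      then obtain v where v: "\<exists>j<Suc n. v j \<noteq> 0" "\<forall>i<Suc n. (\<Sum>j<Suc n. K i j * v j) = 0"
        unfolding ddet_eq_0_iff by blast
      obtain p x' where p: "p < Suc n"
        "\<forall>i<Suc n. (\<Sum>j<n. K i (insert_index p j) * x' j) = (\<Sum>j<Suc n. K i j * x j)"
        using drop_column[OF v, of x] by blast
      have "tn_kernel (Suc n) n (\<lambda>i j. K i (insert_index p j))"
        by (rule tn_kernel_comp[OF Suc.prems, of "\<lambda>i. i"])
           (use p(1) in \<open>auto simp: strict_mono_def insert_index_def\<close>)
      from Suc.IH[OF this, of x'] obtain i where "i < Suc n"
        "(-1) ^ i * (\<Sum>j<n. K i (insert_index p j) * x' j) \<le> 0" by blast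
      with p(2)[rule_format, of i] alt[of i] show False by simp
    next
      case False
      define y where "y i = (\<Sum>j<Suc n. K i j * x j)" for i
      define C where "C i j = (if j = Suc n then y i else K i j)" for i j
      have "ddet (Suc (Suc n)) C = 0"
        unfolding ddet_eq_0_iff
        by (rule exI[of _ "\<lambda>j. if j = Suc n then -1 else x j"]) (auto simp: C_def y_def)
      moreover have "ddet (Suc (Suc n)) C = (\<Sum>i<Suc (Suc n). y i * ((-1) ^ (i + Suc n) *
          ddet (Suc n) (\<lambda>a b. K (insert_index i a) b)))"
        unfolding ddet_col[of "Suc n" "Suc n" C, OF lessI]
        by (intro sum.cong refl arg_cong2[where f = "(*)"] ddet_cong)
           (auto simp: C_def insert_index_def)
      ultimately have "0 = (-1) ^ Suc n * (\<Sum>i<Suc (Suc n). y i * ((-1) ^ (i + Suc n) *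
          ddet (Suc n) (\<lambda>a b. K (insert_index i a) b)))" by simp
      also have "\<dots> = (\<Sum>i<Suc (Suc n). ((-1) ^ i * y i) * ddet (Suc n) (\<lambda>a b. K (insert_index i a) b))"
        unfolding sum_distrib_left
      proof (intro sum.cong refl)
        fix i
        have "(-1) ^ Suc n * (-1) ^ (i + Suc n) = ((-1) ^ i :: real)"
          by (simp add: power_add)
        moreover have "A * (B * (C * D)) = ((A * C) * B) * D" for A B C D :: real by simp
        ultimately show "(- 1) ^ Suc n * (y i * ((-1) ^ (i + Suc n) * ddet (Suc n) (\<lambda>a b. K (insert_index i a) b)))
            = ((-1) ^ i * y i) * ddet (Suc n) (\<lambda>a b. K (insert_index i a) b)"
          by (simp only:)
      qed
      also have "\<dots> > 0"
      proof (rule sum_pos2[of _ "Suc n"])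
        have M: "ddet (Suc n) (\<lambda>a b. K (insert_index i a) b) \<ge> 0" if "i < Suc (Suc n)" for i
          by (rule tn_kernelD[OF Suc.prems])
             (use that in \<open>auto intro: strict_mono_on_id insert_index_strict_mono_on insert_index_less\<close>)
        show "0 \<le> ((-1) ^ i * y i) * ddet (Suc n) (\<lambda>a b. K (insert_index i a) b)"
          if "i \<in> {..<Suc (Suc n)}" for i
          using that M[of i] alt[of i] by (auto simp: y_def)
        have "ddet (Suc n) (\<lambda>a b. K (insert_index (Suc n) a) b) = ddet (Suc n) K"
          by (rule ddet_cong) (auto simp: insert_index_def)
        then have "0 < ddet (Suc n) (\<lambda>a b. K (insert_index (Suc n) a) b)"
          using M[of "Suc n"] False by simp
        moreover have "0 < (-1) ^ Suc n * y (Suc n)"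
          unfolding y_def by (rule alt) simp
        ultimately show "0 < ((-1) ^ Suc n * y (Suc n)) * ddet (Suc n) (\<lambda>a b. K (insert_index (Suc n) a) b)"
          by (rule mult_pos_pos[rotated])
      qed auto
      finally show False by simp
    qed
  qed
qed

text \<open>Columns are discarded along kernel vectors until the kernel is square and non-singular,
  where Cramer's rule gives the sign of every coordinate of \<open>x\<close>; fewer columns than
  rows are impossible. The positions \<open>c\<close> and the exact signs are recorded, not just the
  number of sign changes, because the root argument looks for runs of consecutive positions.\<close>

theorem variation_diminishing:
  assumes "tn_kernel m n K"
    and "\<And>i. i < m \<Longrightarrow> (-1) ^ i * (\<Sum>j<n. K i j * x j) > 0"
  obtains c where "strict_mono_on {..<m} c" "\<And>j. j < m \<Longrightarrow> c j < n \<and> (-1) ^ j * x (c j) > 0"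
proof -
  have excess: False if "n' < m" "tn_kernel m n' K'" 
     "\<And>i. i < m \<Longrightarrow> (-1) ^ i * (\<Sum>j<n'. K' i j * x' j) > 0" for n' K' x'
  proof -
    have "tn_kernel (Suc n') n' K'"
      using tn_kernel_comp[OF that(2), of "\<lambda>i. i" "\<lambda>i. i" "Suc n'" n'] that(1) by (auto simp: strict_mono_def)
    from tn_kernel_no_excess_alternation[OF this, of x'] obtain i where
      "i < Suc n'" "(-1) ^ i * (\<Sum>j<n'. K' i j * x' j) \<le> 0" by blast
    with that(1) that(3)[of i] show False by simp
  qed
  have "\<exists>c. strict_mono_on {..<m} c \<and> (\<forall>j<m. c j < n \<and> (-1) ^ j * x (c j) > 0)"
    using assms
  proof (induction n arbitrary: K x)
    case 0
    then have "m = 0" using excess[OF _ 0] by auto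
    then show ?case by auto
  next
    case (Suc n)
    have drop: ?case if v: "\<exists>j<Suc n. v j \<noteq> 0" "\<forall>i<m. (\<Sum>j<Suc n. K i j * v j) = 0" for v
    proof -
      obtain p x' where p: "p < Suc n"
        "\<forall>i<m. (\<Sum>j<n. K i (insert_index p j) * x' j) = (\<Sum>j<Suc n. K i j * x j)"
        "\<forall>s j. s \<in> {1, -1} \<longrightarrow> j < n \<longrightarrow> s * x' j > 0 \<longrightarrow> s * x (insert_index p j) > 0"
        using drop_column[OF v, of x] by blast
      have "tn_kernel m n (\<lambda>i j. K i (insert_index p j))"
        by (rule tn_kernel_comp[OF Suc.prems(1), of "\<lambda>i. i"])
           (use p(1) in \<open>auto simp: strict_mono_def insert_index_def\<close>)
      from Suc.IH[OF this, of x'] Suc.prems(2) p(2) obtain c where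
        c: "strict_mono_on {..<m} c" "\<And>j. j < m \<Longrightarrow> c j < n \<and> (-1) ^ j * x' (c j) > 0" by auto
      have "(-1) ^ j \<in> {1, -1::real}" for j :: nat by (cases "even j") auto
      then have "(-1) ^ j * x (insert_index p (c j)) > 0" if "j < m" for j
        using p(3) c(2) that by blast
      moreover have "strict_mono_on {..<m} (\<lambda>j. insert_index p (c j))"
        using c(1) insert_index_strict_mono by (auto simp: strict_mono_on_def strict_mono_def)
      moreover have "insert_index p (c j) < Suc n" if "j < m" for j
        using insert_index_less[OF p(1)] c(2) that by auto
      ultimately show ?thesis by blast
    qed
    consider "Suc n < m" | "Suc n = m" | "m \<le> n" by linarith
    then show ?case
    proof cases
      case 1
      then show ?thesis using excess[OF _ Suc.prems] by auto
    next
      case 3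
      \<comment> \<open>Padding with zero rows makes the kernel square and singular, which yields a
        kernel vector.\<close>
      have "ddet (Suc n) (\<lambda>i j. if i < m then K i j else 0) = 0"
        using 3 by (subst ddet_row[of n]) auto
      then obtain v where v: "\<exists>j<Suc n. v j \<noteq> 0"
        "\<forall>i<Suc n. (\<Sum>j<Suc n. (if i < m then K i j else 0) * v j) = 0"
        unfolding ddet_eq_0_iff by blast
      have "(\<Sum>j<Suc n. K i j * v j) = 0" if "i < m" for i
        using v(2)[rule_format, of i] that 3 by simp
      with drop v show ?thesis by blast
    next
      case 2
      show ?thesis
      proof (cases "ddet (Suc n) K = 0")
        case True
        then obtain v where v: "\<exists>j<Suc n. v j \<noteq> 0" "\<forall>i<m. (\<Sum>j<Suc n. K i j * v j) = 0"
          unfolding ddet_eq_0_iff 2 by blast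
        then show ?thesis using drop by blast
      next
        case False
        define y where "y i = (\<Sum>j<Suc n. K i j * x j)" for i
        have "ddet (Suc n) (\<lambda>i j. K i j) \<ge> 0"
          by (rule tn_kernelD[OF Suc.prems(1)]) (auto simp: 2 strict_mono_on_id)
        with False have pos: "ddet (Suc n) K > 0" by simp
        have "(-1) ^ k * x k > 0" if k: "k < Suc n" for k
        proof -
          define M where "M i = ddet n (\<lambda>a b. K (insert_index i a) (insert_index k b))" for i
          have M: "M i \<ge> 0" if "i < Suc n" for i
            unfolding M_def using that k 2 by (intro minor_nonneg[OF Suc.prems(1)]) auto
          have "x k * ddet (Suc n) K = ddet (Suc n) (\<lambda>i j. if j = k then y i else K i j)"
            unfolding y_def by (simp only: ddet_replace_col[OF k])
          also have "\<dots> = (\<Sum>i<Suc n. y i * ((-1) ^ (i + k) * M i))"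
            unfolding ddet_col[OF k] M_def
            by (intro sum.cong refl arg_cong2[where f = "(*)"] ddet_cong) (auto simp: insert_index_def)
          finally have "(-1) ^ k * x k * ddet (Suc n) K = (-1) ^ k * (\<Sum>i<Suc n. y i * ((-1) ^ (i + k) * M i))"
            by simp
          also have "\<dots> = (\<Sum>i<Suc n. (-1) ^ i * y i * M i)"
            unfolding sum_distrib_left
          proof (intro sum.cong refl)
            fix i
            have "(-1) ^ k * (-1) ^ (i + k) = ((-1) ^ i :: real)"
              by (simp add: power_add)
            moreover have "A * (B * (C * D)) = ((A * C) * B) * D" for A B C D :: real by simp
            ultimately show "(- 1) ^ k * (y i * ((-1) ^ (i + k) * M i)) = (-1) ^ i * y i * M i"
              by (simp only:)
          qed
          also have "\<dots> > 0"
          proof -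
            have "\<exists>i<Suc n. M i \<noteq> 0"
            proof (rule ccontr)
              assume "\<not> ?thesis"
              then have "ddet (Suc n) K = 0" unfolding ddet_col[OF k] M_def by simp
              with False show False by simp
            qed
            then obtain i where i: "i < Suc n" "M i > 0" using M by (auto simp: less_le)
            have y: "0 < (-1) ^ i * y i" if "i < Suc n" for i
              unfolding y_def using that 2 by (intro Suc.prems(2)) simp
            show ?thesis
            proof (rule sum_pos2[of _ i])
              show "0 < (-1) ^ i * y i * M i" by (rule mult_pos_pos[OF y[OF i(1)] i(2)])
              show "0 \<le> (-1) ^ k * y k * M k" if "k \<in> {..<Suc n}" for k
                using that by (intro mult_nonneg_nonneg[OF less_imp_le[OF y] M]) auto
            qed (use i in auto)
          qed
          finally show ?thesis using pos by (simp add: zero_less_mult_iff)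
        qed
        then show ?thesis using 2 by (intro exI[of _ "\<lambda>i. i"]) (auto simp: strict_mono_on_id)
      qed
    qed
  qed
  then show thesis using that by blast
qed

section \<open>Real roots of finite totally non-negative sequences\<close>

text \<open>The open arc where the cosine is negative has length \<open>pi\<close>, so steps of
  length \<open>\<phi> < pi\<close> cannot jump over it, and one turn bounds the waiting time
  uniformly in \<open>n0\<close>. For \<open>\<phi> = pi\<close> the values alternate between 1 and
  -1. The phase \<open>\<psi> = pi\<close> serves to reverse the sign.\<close>

lemma cos_neg_on_progression:
  assumes "0 < \<phi>" "\<phi> \<le> pi"
  obtains L :: nat where "\<And>n0 \<psi>. \<psi> \<in> {0, pi} \<Longrightarrow> \<exists>n\<ge>n0. n \<le> n0 + L \<and> cos (real n * \<phi> + \<psi>) < 0"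
proof (cases "\<phi> = pi")
  case True
  have "\<exists>n\<ge>n0. n \<le> n0 + 1 \<and> cos (real n * \<phi> + \<psi>) < 0" if "\<psi> \<in> {0, pi}" for n0 \<psi>
    using that by (cases "even n0 \<longleftrightarrow> \<psi> = 0")
      (auto intro: exI[of _ n0] exI[of _ "Suc n0"] simp: True cos_add distrib_right)
  then show thesis using that by blast
next
  case False
  with assms have \<phi>: "0 < \<phi>" "\<phi> < pi" by auto
  have "\<exists>n\<ge>n0. n \<le> n0 + nat \<lceil>2 * pi / \<phi> + 1\<rceil> \<and> cos (real n * \<phi> + \<psi>) < 0" if "\<psi> \<in> {0, pi}" for n0 \<psi>
  proof -
    define t0 where "t0 = real n0 * \<phi> + \<psi>"
    \<comment> \<open>\<open>u\<close> is the first point congruent to \<open>pi / 2\<close> modulo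
      \<open>2 * pi\<close> at or after \<open>t0\<close>, and \<open>n\<close> is the first index
      beyond it. The overshoot \<open>w\<close> then satisfies \<open>0 < w\<close> and
      \<open>w \<le> \<phi>\<close>.\<close>
    define k where "k = \<lceil>(t0 - pi / 2) / (2 * pi)\<rceil>"
    define u where "u = pi / 2 + 2 * pi * of_int k"
    have "(t0 - pi / 2) / (2 * pi) \<le> of_int k" "of_int k < (t0 - pi / 2) / (2 * pi) + 1"
      unfolding k_def by linarith+
    then have u: "t0 \<le> u" "u < t0 + 2 * pi"
      by (auto simp: u_def field_simps)
    define n where "n = nat (\<lfloor>(u - \<psi>) / \<phi>\<rfloor> + 1)"
    have n0: "real n0 \<le> (u - \<psi>) / \<phi>" using u \<phi> by (simp add: t0_def field_simps)
    then have "0 \<le> \<lfloor>(u - \<psi>) / \<phi>\<rfloor>" by (metis le_floor_iff of_int_0 of_nat_0_le_iff order_trans)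
    then have n: "real n = of_int \<lfloor>(u - \<psi>) / \<phi>\<rfloor> + 1" unfolding n_def by simp
    have nb: "(u - \<psi>) / \<phi> < real n" "real n \<le> (u - \<psi>) / \<phi> + 1" unfolding n by linarith+
    have "n0 \<le> n" using nb n0 by linarith
    moreover have "n \<le> n0 + nat \<lceil>2 * pi / \<phi> + 1\<rceil>"
    proof -
      have "(u - \<psi>) / \<phi> \<le> (t0 + 2 * pi - \<psi>) / \<phi>" using u \<phi> by (intro divide_right_mono) auto
      also have "\<dots> = real n0 + 2 * pi / \<phi>" using \<phi> by (simp add: t0_def field_simps)
      finally have "real n \<le> real n0 + (2 * pi / \<phi> + 1)" using nb by linarith
      then show ?thesis by linarith
    qed
    moreover have "cos (real n * \<phi> + \<psi>) < 0"
    proof -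
      define w where "w = real n * \<phi> + \<psi> - u"
      have "0 < w" "w \<le> \<phi>" using nb \<phi> by (auto simp: w_def field_simps)
      then have "sin w > 0" using \<phi> by (intro sin_gt_zero) auto
      moreover have "cos (real n * \<phi> + \<psi>) = cos ((w + pi / 2) + 2 * pi * of_int k)"
        by (simp add: w_def u_def)
      moreover have "\<dots> = - sin w"
        by (simp add: cos_add sin_int_2pin[of k] cos_int_2pin[of k])
      ultimately show ?thesis by simp
    qed
    ultimately show ?thesis by blast
  qed
  then show thesis using that by blast
qed

lemma Re_power_changes_sign:
  assumes "\<not> (Im z = 0 \<and> Re z \<ge> 0)"
  obtains L :: nat where "\<And>n0 s. s \<in> {1, -1} \<Longrightarrow> \<exists>n\<ge>n0. n \<le> n0 + L \<and> s * Re (z ^ n) < 0"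
proof -
  have z: "z \<noteq> 0" using assms by auto
  define \<phi> where "\<phi> = \<bar>Arg z\<bar>"
  have "Arg z \<noteq> 0" using assms by (auto simp: Arg_eq_0 complex_is_Real_iff)
  then have "0 < \<phi>" "\<phi> \<le> pi" using Arg_bounded[of z] by (auto simp: \<phi>_def)
  then obtain L where L: "\<And>n0 \<psi>. \<psi> \<in> {0, pi} \<Longrightarrow> \<exists>n\<ge>n0. n \<le> n0 + L \<and> cos (real n * \<phi> + \<psi>) < 0"
    by (rule cos_neg_on_progression) (rule that)
  have Re: "Re (z ^ n) = norm z ^ n * cos (real n * \<phi>)" for n
  proof -
    have "z ^ n = (of_real (norm z) * exp (\<i> * of_real (Arg z))) ^ n"
      using Arg_eq[OF z] by simp
    also have "\<dots> = of_real (norm z ^ n) * cis (real n * Arg z)"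
      by (simp add: power_mult_distrib cis_conv_exp[symmetric] Complex.DeMoivre)
    finally have "Re (z ^ n) = norm z ^ n * cos (real n * Arg z)" by simp
    also have "cos (real n * Arg z) = cos (real n * \<phi>)"
      by (auto simp: \<phi>_def abs_if)
    finally show ?thesis .
  qed
  show thesis
  proof (rule that[of L])
    fix n0 and s :: real assume s: "s \<in> {1, -1}"
    define \<psi> where "\<psi> = (if s = 1 then 0 else pi)"
    have "\<psi> \<in> {0, pi}" by (auto simp: \<psi>_def)
    from L[OF this, of n0] obtain n where n: "n \<ge> n0" "n \<le> n0 + L" "cos (real n * \<phi> + \<psi>) < 0" by blast
    have "cos (real n * \<phi> + \<psi>) = s * cos (real n * \<phi>)" using s by (auto simp: \<psi>_def)
    then have neg: "s * cos (real n * \<phi>) < 0" using n(3) by simp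
    have "norm z ^ n > 0" using z by simp
    from mult_pos_neg[OF this neg] have "norm z ^ n * (s * cos (real n * \<phi>)) < 0" .
    then show "\<exists>n\<ge>n0. n \<le> n0 + L \<and> s * Re (z ^ n) < 0"
      using n by (intro exI[of _ n]) (simp add: Re mult_ac)
  qed
qed

text \<open>Pigeonhole: \<open>m\<close> increasing values below \<open>m + N\<close> skip at most
  \<open>N\<close> numbers, and a block of length \<open>L\<close> that is not consecutive skips at
  least one. So one of \<open>N + 1\<close> successive blocks is consecutive.\<close>

lemma strict_mono_on_consecutive_run:
  fixes c :: "nat \<Rightarrow> nat"
  assumes c: "strict_mono_on {..<m} c" and range: "\<And>j. j < m \<Longrightarrow> c j < m + N"
    and m: "(N + 1) * L < m"
  obtains j where "j + L < m" "\<And>l. l \<le> L \<Longrightarrow> c (j + l) = c j + l"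
proof -
  have step: "c i + 1 \<le> c (Suc i)" if "Suc i < m" for i
    using strict_mono_onD[OF c, of i "Suc i"] that by auto
  have grow: "c i + k \<le> c (i + k)" if "i + k < m" for i k
    using that
  proof (induction k)
    case (Suc k)
    then show ?case using step[of "i + k"] by auto
  qed auto
  have bound: "c j \<le> j + N" if "j < m" for j
    using grow[of j "m - 1 - j"] range[of "m - 1"] that by auto
  have "\<exists>t\<le>N. c (t * L + L) = c (t * L) + L"
  proof (rule ccontr)
    assume none: "\<not> ?thesis"
    have lt: "t * L < m" if "t \<le> N + 1" for t
      using m that by (meson le_less_trans mult_le_mono1)
    have "c (t * L) \<ge> t * L + t" if "t \<le> N + 1" for t
      using that
    proof (induction t)
      case (Suc t)
      have "t * L + L < m" using lt[of "Suc t"] Suc.prems by (simp add: add.commute)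
      then have "c (t * L) + L \<le> c (t * L + L)" by (rule grow)
      moreover have "c (t * L + L) \<noteq> c (t * L) + L" using none Suc.prems by auto
      ultimately show ?case using Suc by (simp add: add.commute)
    qed auto
    from this[of "N + 1"] bound[OF lt, of "N + 1"] show False by auto
  qed
  then obtain t where t: "t \<le> N" "c (t * L + L) = c (t * L) + L" by blast
  have tm: "t * L + L < m"
    using m t(1) by (metis Suc_eq_plus1 add.commute le_less_trans mult_Suc mult_le_mono1 Suc_le_mono)
  show thesis
  proof (rule that[of "t * L"])
    show "t * L + L < m" by fact
    fix l assume l: "l \<le> L"
    have "c (t * L) + l \<le> c (t * L + l)" using l tm by (intro grow) auto
    moreover have "c (t * L + l) + (L - l) \<le> c (t * L + l + (L - l))" using l tm by (intro grow) auto
    ultimately show "c (t * L + l) = c (t * L) + l" using t(2) l by simp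
  qed
qed

text \<open>For non-negative coefficients, not all zero, this is \<open>(poly p 1)\<^sup>2\<close>
  times the variance of the distribution with weights proportional to the coefficients.\<close>

definition variance_form :: "real poly \<Rightarrow> real" where
  "variance_form p = poly p 1 * (poly (pderiv (pderiv p)) 1 + poly (pderiv p) 1) - (poly (pderiv p) 1)\<^sup>2"

text \<open>For \<open>r > 0\<close> the factor adds an independent Bernoulli variable of variance
  \<open>r / (1 + r)\<^sup>2\<close>; denominators are cleared.\<close>

lemma variance_form_linear_factor:
  "variance_form ([:r, 1:] * q) = (1 + r)\<^sup>2 * variance_form q + r * (poly q 1)\<^sup>2"
  by (simp add: variance_form_def pderiv_mult pderiv_add pderiv_pCons pderiv_smult power2_eq_square algebra_simps)

text \<open>Linear factors are split off one root at a time, and each adds a variance of at most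
  \<open>1 / 4\<close> because \<open>4 * r \<le> (1 + r)\<^sup>2\<close>.\<close>

lemma variance_form_le:
  fixes p :: "real poly"
  assumes "\<And>z. poly (map_poly complex_of_real p) z = 0 \<Longrightarrow> Im z = 0 \<and> Re z < 0"
  shows "variance_form p \<le> of_nat (degree p) / 4 * (poly p 1)\<^sup>2"
  using assms
proof (induction "degree p" arbitrary: p)
  case 0
  then obtain c where "p = [:c:]" by (metis degree_eq_zeroE)
  then show ?case by (simp add: variance_form_def)
next
  case (Suc n)
  have "degree (map_poly complex_of_real p) = Suc n"
    using Suc.hyps(2) by (simp add: degree_map_poly)
  then have "\<not> constant (poly (map_poly complex_of_real p))" by (simp add: constant_degree)
  then obtain z where z: "poly (map_poly complex_of_real p) z = 0"
    using fundamental_theorem_of_algebra by blast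
  define r where "r = - Re z"
  have r: "r > 0" "z = complex_of_real (- r)"
    using Suc.prems[OF z] by (auto simp: r_def complex_eq_iff)
  have "poly (map_poly complex_of_real p) (complex_of_real (- r)) = complex_of_real (poly p (- r))"
    by (induction p) (simp_all add: map_poly_pCons)
  with z r have "poly p (- r) = 0" by simp
  then obtain q where p: "p = [:r, 1:] * q" by (auto simp: poly_eq_0_iff_dvd elim: dvdE)
  have q0: "q \<noteq> 0" using p Suc.hyps(2) by auto
  then have dq: "degree q = n" using Suc.hyps(2) unfolding p by (subst (asm) degree_mult_eq) auto
  have "Im w = 0 \<and> Re w < 0" if "poly (map_poly complex_of_real q) w = 0" for w
  proof -
    have "map_poly complex_of_real p = pCons 0 (map_poly complex_of_real q) +
        Polynomial.smult (complex_of_real r) (map_poly complex_of_real q)"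
      unfolding p by (rule poly_eqI) (simp add: coeff_map_poly coeff_pCons split: nat.split)
    then have "poly (map_poly complex_of_real p) w = (complex_of_real r + w) * poly (map_poly complex_of_real q) w"
      by (simp add: algebra_simps)
    then show ?thesis using that Suc.prems by simp
  qed
  with Suc.hyps(1)[of q] dq have IH: "variance_form q \<le> real n / 4 * (poly q 1)\<^sup>2" by simp
  have "4 * r \<le> (1 + r)\<^sup>2" using sum_squares_ge_zero[of "1 - r" 0] by (simp add: power2_eq_square algebra_simps)
  have "variance_form p = (1 + r)\<^sup>2 * variance_form q + r * (poly q 1)\<^sup>2"
    unfolding p by (rule variance_form_linear_factor)
  also have "\<dots> \<le> (1 + r)\<^sup>2 * (real n / 4 * (poly q 1)\<^sup>2) + (1 + r)\<^sup>2 / 4 * (poly q 1)\<^sup>2"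
    using IH \<open>4 * r \<le> (1 + r)\<^sup>2\<close> by (intro add_mono mult_left_mono mult_right_mono) auto
  also have "\<dots> = of_nat (degree p) / 4 * (poly p 1)\<^sup>2"
  proof -
    have "poly p 1 = (1 + r) * poly q 1" by (simp add: p algebra_simps)
    then have "(poly p 1)\<^sup>2 = (1 + r)\<^sup>2 * (poly q 1)\<^sup>2" by (simp only: power_mult_distrib)
    moreover have "A * (real n / 4 * B) + A / 4 * B = real (Suc n) / 4 * (A * B)" for A B
      by (simp add: field_simps)
    ultimately show ?thesis
      unfolding Suc.hyps(2)[symmetric] by (simp only:)
  qed
  finally show ?case .
qed

definition poly_of_seq :: "nat \<Rightarrow> (nat \<Rightarrow> real) \<Rightarrow> real poly" where
  "poly_of_seq N a = (\<Sum>k\<le>N. monom (a k) k)"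

lemma pderiv_sum_atMost: "pderiv (\<Sum>k\<le>N. f k) = (\<Sum>k\<le>(N::nat). pderiv (f k))"
  by (induction N) (simp_all add: pderiv_add)

text \<open>Twice a variance is the expected squared difference of two independent copies. In this
  form a lower bound follows by keeping only some of the terms.\<close>

lemma variance_form_poly_of_seq:
  "2 * variance_form (poly_of_seq N a) = (\<Sum>i\<le>N. \<Sum>j\<le>N. a i * a j * (real i - real j)\<^sup>2)"
proof -
  have 0: "poly (poly_of_seq N a) 1 = (\<Sum>k\<le>N. a k)"
    by (simp add: poly_of_seq_def poly_sum poly_monom)
  have 1: "poly (pderiv (poly_of_seq N a)) 1 = (\<Sum>k\<le>N. real k * a k)"
    by (simp add: poly_of_seq_def poly_sum poly_monom pderiv_sum_atMost pderiv_monom)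
  have "poly (pderiv (pderiv (poly_of_seq N a))) 1 = (\<Sum>k\<le>N. real (k - 1) * (real k * a k))"
    by (simp add: poly_of_seq_def poly_sum poly_monom pderiv_sum_atMost pderiv_monom)
  also have "\<dots> + (\<Sum>k\<le>N. real k * a k) = (\<Sum>k\<le>N. (real k)\<^sup>2 * a k)"
    unfolding sum.distrib[symmetric]
    by (intro sum.cong refl) (auto simp: power2_eq_square algebra_simps of_nat_diff split: nat.splits nat_diff_split)
  finally have 2: "poly (pderiv (pderiv (poly_of_seq N a))) 1 + poly (pderiv (poly_of_seq N a)) 1 =
    (\<Sum>k\<le>N. (real k)\<^sup>2 * a k)" using 1 by simp
  have "(\<Sum>i\<le>N. \<Sum>j\<le>N. a i * a j * (real i - real j)\<^sup>2) =
    (\<Sum>i\<le>N. \<Sum>j\<le>N. ((real i)\<^sup>2 * a i) * a j + a i * ((real j)\<^sup>2 * a j) - 2 * ((real i * a i) * (real j * a j)))"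
    by (intro sum.cong refl) (simp add: power2_eq_square algebra_simps)
  also have "\<dots> = 2 * ((\<Sum>k\<le>N. a k) * (\<Sum>k\<le>N. (real k)\<^sup>2 * a k) - (\<Sum>k\<le>N. real k * a k)\<^sup>2)"
    by (simp add: sum.distrib sum_subtractf sum_distrib_left[symmetric] sum_distrib_right[symmetric]
        power2_eq_square mult.commute)
  finally show ?thesis by (simp add: variance_form_def 0 1 2[unfolded 1])
qed

lemma degree_poly_of_seq: "degree (poly_of_seq N a) \<le> N"
  unfolding poly_of_seq_def by (rule degree_sum_le) (auto intro: order_trans[OF degree_monom_le])

lemma poly_map_poly_of_seq:
  "poly (map_poly complex_of_real (poly_of_seq N a)) z = (\<Sum>k\<le>N. complex_of_real (a k) * z ^ k)"
proof -
  have "map_poly complex_of_real (poly_of_seq N a) = (\<Sum>k\<le>N. monom (complex_of_real (a k)) k)"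
    unfolding poly_of_seq_def
    by (rule poly_eqI) (simp add: coeff_map_poly coeff_sum coeff_monom if_distrib cong: if_cong)
  then show ?thesis by (simp add: poly_sum poly_monom)
qed

text \<open>With offset \<open>N\<close> and \<open>m + N\<close> columns the support of every row
  \<open>i < m\<close> fits inside the window, so no boundary terms occur.\<close>

lemma convolution_reindex:
  fixes a :: "int \<Rightarrow> real" and h :: "nat \<Rightarrow> real"
  assumes zero: "\<And>k. k < 0 \<or> k > int N \<Longrightarrow> a k = 0" and i: "i < m"
  shows "(\<Sum>j<m + N. a (int N + int i - int j) * h j) = (\<Sum>k\<le>N. a (int k) * h (N + i - k))"
proof -
  have "a (int N + int i - int j) = 0" if "j \<notin> {i..N + i}" for j
    by (rule zero) (use that in auto)
  then have "(\<Sum>j<m + N. a (int N + int i - int j) * h j) = (\<Sum>j\<in>{i..N + i}. a (int N + int i - int j) * h j)"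
    using i by (intro sum.mono_neutral_right) auto
  also have "\<dots> = (\<Sum>k\<le>N. a (int k) * h (N + i - k))"
    by (rule sum.reindex_bij_witness[of _ "\<lambda>k. N + i - k" "\<lambda>j. N + i - j"]) (auto simp: of_nat_diff)
  finally show ?thesis .
qed

lemma exists_small_multiplier:
  fixes u v :: "nat \<Rightarrow> real"
  obtains \<delta> where "\<delta> > 0" "\<And>j. j < n \<Longrightarrow> v j \<noteq> 0 \<Longrightarrow> \<delta> * \<bar>u j\<bar> < \<bar>v j\<bar>"
proof -
  have "eventually (\<lambda>\<delta>::real. v j \<noteq> 0 \<longrightarrow> \<delta> * \<bar>u j\<bar> < \<bar>v j\<bar>) (at_right 0)" for j
  proof (cases "v j = 0")
    case False
    have "((\<lambda>\<delta>::real. \<delta> * \<bar>u j\<bar>) \<longlongrightarrow> 0 * \<bar>u j\<bar>) (at_right 0)"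
      by (intro tendsto_intros)
    then show ?thesis using order_tendstoD(2)[of "\<lambda>\<delta>. \<delta> * \<bar>u j\<bar>" _ "at_right 0" "\<bar>v j\<bar>"] False
      by (auto elim: eventually_mono)
  qed auto
  then have "eventually (\<lambda>\<delta>::real. \<forall>j\<in>{..<n}. v j \<noteq> 0 \<longrightarrow> \<delta> * \<bar>u j\<bar> < \<bar>v j\<bar>) (at_right 0)"
    by (intro eventually_ball_finite) auto
  then have "eventually (\<lambda>\<delta>::real. 0 < \<delta> \<and> (\<forall>j\<in>{..<n}. v j \<noteq> 0 \<longrightarrow> \<delta> * \<bar>u j\<bar> < \<bar>v j\<bar>)) (at_right 0)"
    by (intro eventually_conj eventually_at_right_less)
  then obtain \<delta> where "0 < \<delta> \<and> (\<forall>j\<in>{..<n}. v j \<noteq> 0 \<longrightarrow> \<delta> * \<bar>u j\<bar> < \<bar>v j\<bar>)"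
    using eventually_happens[of _ "at_right (0::real)"] by auto
  then show thesis using that by auto
qed

text \<open>For a root \<open>z\<close> with inverse \<open>w\<close>, the Toeplitz kernel
  annihilates \<open>Re (w ^ j)\<close>. A tiny multiple of \<open>\<beta> ^ j\<close> with
  \<open>\<beta> < 0\<close> makes the image strictly alternating, so variation diminution forces
  alternation at \<open>m\<close> of the \<open>m + N\<close> positions, in particular along a long
  consecutive run. There \<open>Re ((- w) ^ n)\<close> would keep a weak sign, which is impossible
  unless \<open>- w\<close> is a non-negative real.\<close>

lemma finite_totally_nonneg_roots:
  fixes a :: "int \<Rightarrow> real"
  assumes tn: "totally_nonneg a" and zero: "\<And>k. k < 0 \<or> k > int N \<Longrightarrow> a k = 0" and a0: "a 0 \<noteq> 0"
    and root: "(\<Sum>k\<le>N. complex_of_real (a (int k)) * z ^ k) = 0"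
  shows "Im z = 0 \<and> Re z < 0"
proof (rule ccontr)
  assume neg: "\<not> ?thesis"
  have z: "z \<noteq> 0"
  proof
    assume "z = 0"
    then have "(\<Sum>k\<le>N. complex_of_real (a (int k)) * z ^ k) = (\<Sum>k\<in>{0}. complex_of_real (a (int k)) * z ^ k)"
      by (intro sum.mono_neutral_right) auto
    with root a0 show False by simp
  qed
  define w where "w = inverse z"
  have w: "w \<noteq> 0" "z = inverse w" using z by (auto simp: w_def)
  have "\<not> (Im (- w) = 0 \<and> Re (- w) \<ge> 0)"
  proof
    assume *: "Im (- w) = 0 \<and> Re (- w) \<ge> 0"
    then have "w = complex_of_real (Re w)" "Re w < 0" using w(1) by (auto simp: complex_eq_iff less_le)
    then have "z = complex_of_real (inverse (Re w))" unfolding w(2) by (metis of_real_inverse)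
    then have "Im z = 0" "Re z = inverse (Re w)"
      by (metis Im_complex_of_real) (metis Re_complex_of_real \<open>z = complex_of_real (inverse (Re w))\<close>)
    with \<open>Re w < 0\<close> neg show False by simp
  qed
  then obtain L where L: "\<And>n0 s. s \<in> {1, -1} \<Longrightarrow> \<exists>n\<ge>n0. n \<le> n0 + L \<and> s * Re ((- w) ^ n) < 0"
    by (rule Re_power_changes_sign) (rule that)
  \<comment> \<open>Long enough for \<open>N + 1\<close> blocks of length \<open>L\<close>; the
    extra 1 makes the inequality strict.\<close>
  define m where "m = (N + 1) * L + 1"
  define p where "p = poly_of_seq N (\<lambda>k. a (int k))"
  have p: "poly p x = (\<Sum>k\<le>N. a (int k) * x ^ k)" for x
    by (simp add: p_def poly_of_seq_def poly_sum poly_monom)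
  have "poly p 0 = a 0" unfolding p by (subst sum.remove[of _ 0]) auto
  then have "p \<noteq> 0" using a0 by auto
  then have "finite {x. poly p x = 0}" by (rule poly_roots_finite)
  moreover have "infinite {..<0::real}" by (rule infinite_Iio)
  ultimately obtain x where x: "x < 0" "poly p x \<noteq> 0"
    by (metis (mono_tags, lifting) finite_subset lessThan_iff mem_Collect_eq subsetI)
  define \<beta> where "\<beta> = inverse x"
  have \<beta>: "\<beta> < 0" using x by (simp add: \<beta>_def)
  obtain \<delta> where \<delta>: "\<delta> > 0" "\<And>j. j < m + N \<Longrightarrow> Re (w ^ j) \<noteq> 0 \<Longrightarrow> \<delta> * \<bar>\<beta> ^ j\<bar> < \<bar>Re (w ^ j)\<bar>"
    using exists_small_multiplier[of "m + N" "\<lambda>j. Re (w ^ j)" "\<lambda>j. \<beta> ^ j"] by blast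
  \<comment> \<open>The sign makes the image positive in row 0; the alternation then comes from the
    powers of the negative number \<open>\<beta>\<close>.\<close>
  define e where "e = \<delta> * sgn (\<beta> ^ N * poly p x)"
  have e: "\<bar>e\<bar> = \<delta>" using \<delta>(1) x(2) \<beta> by (simp add: e_def abs_mult)
  define g where "g j = Re (w ^ j) + e * \<beta> ^ j" for j
  define K where "K i j = a (int N + int i - int j)" for i j
  have K: "tn_kernel m (m + N) K"
    unfolding tn_kernel_def
  proof (intro allI impI)
    fix k and r c :: "nat \<Rightarrow> nat"
    assume "strict_mono_on {..<k} r" "strict_mono_on {..<k} c"
    then show "0 \<le> ddet k (\<lambda>i j. K (r i) (c j))"
      unfolding K_def using totally_nonnegD[OF tn, of k "\<lambda>i. int N + int (r i)" "\<lambda>j. int (c j)"]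
      by (auto simp: strict_mono_on_def)
  qed
  have conv: "(-1) ^ i * (\<Sum>j<m + N. K i j * g j) > 0" if i: "i < m" for i
  proof -
    have "(\<Sum>j<m + N. K i j * Re (w ^ j)) = (\<Sum>k\<le>N. a (int k) * Re (w ^ (N + i - k)))"
      unfolding K_def by (rule convolution_reindex[OF zero i])
    also have "\<dots> = Re (\<Sum>k\<le>N. complex_of_real (a (int k)) * w ^ (N + i - k))"
      by simp
    also have "(\<Sum>k\<le>N. complex_of_real (a (int k)) * w ^ (N + i - k)) =
        w ^ (N + i) * (\<Sum>k\<le>N. complex_of_real (a (int k)) * z ^ k)"
      unfolding sum_distrib_left
      by (intro sum.cong refl) (simp add: w power_diff power_inverse divide_inverse mult_ac)
    finally have 1: "(\<Sum>j<m + N. K i j * Re (w ^ j)) = 0" using root by simp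
    have "(\<Sum>j<m + N. K i j * \<beta> ^ j) = (\<Sum>k\<le>N. a (int k) * \<beta> ^ (N + i - k))"
      unfolding K_def by (rule convolution_reindex[OF zero i])
    also have "\<dots> = \<beta> ^ (N + i) * poly p x"
      unfolding p sum_distrib_left using x
      by (intro sum.cong refl) (simp add: \<beta>_def power_diff power_inverse divide_inverse mult_ac)
    finally have 2: "(\<Sum>j<m + N. K i j * \<beta> ^ j) = \<beta> ^ (N + i) * poly p x" .
    have "(\<Sum>j<m + N. K i j * g j) = (\<Sum>j<m + N. K i j * Re (w ^ j)) + e * (\<Sum>j<m + N. K i j * \<beta> ^ j)"
      by (simp add: g_def distrib_left sum.distrib sum_distrib_left mult_ac)
    then have "(-1) ^ i * (\<Sum>j<m + N. K i j * g j) = (-1) ^ i * (e * (\<beta> ^ (N + i) * poly p x))"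
      by (simp add: 1 2)
    also have "\<dots> = (- \<beta>) ^ i * \<delta> * (sgn (\<beta> ^ N * poly p x) * (\<beta> ^ N * poly p x))"
      by (simp add: e_def power_add power_minus[of \<beta>] mult_ac)
    also have "sgn (\<beta> ^ N * poly p x) * (\<beta> ^ N * poly p x) = \<bar>\<beta> ^ N * poly p x\<bar>"
      by (simp add: abs_sgn mult.commute)
    finally show ?thesis using \<beta> \<delta>(1) x(2) by simp
  qed
  obtain c where c: "strict_mono_on {..<m} c" "\<And>j. j < m \<Longrightarrow> c j < m + N \<and> (-1) ^ j * g (c j) > 0"
    using variation_diminishing[of m "m + N" K g, OF K conv] by blast
  have "(N + 1) * L < m" by (simp add: m_def)
  then obtain j where j: "j + L < m" "\<And>l. l \<le> L \<Longrightarrow> c (j + l) = c j + l"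
    using strict_mono_on_consecutive_run[OF c(1), of N L] c(2) by blast
  define s where "s = (-1::real) ^ j * (-1) ^ c j"
  have "s \<in> {1, -1}" by (auto simp: s_def minus_one_power_iff)
  from L[OF this, of "c j"] obtain n where n: "n \<ge> c j" "n \<le> c j + L" "s * Re ((- w) ^ n) < 0" by blast
  define l where "l = n - c j"
  have l: "l \<le> L" "n = c j + l" using n by (auto simp: l_def)
  have gn: "(-1) ^ (j + l) * g n > 0" "n < m + N"
    using c(2)[of "j + l"] j l by auto
  have "s * Re ((- w) ^ n) = (-1) ^ (j + l) * Re (w ^ n)"
    unfolding s_def l(2) by (subst power_minus) (auto simp: power_add minus_one_power_iff)
  with n(3) have sgn: "(-1) ^ (j + l) * Re (w ^ n) < 0" by simp
  then have "Re (w ^ n) \<noteq> 0" by auto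
  with \<delta>(2)[OF gn(2)] have "\<bar>g n - Re (w ^ n)\<bar> < \<bar>Re (w ^ n)\<bar>"
    by (simp add: g_def abs_mult e)
  with gn(1) sgn show False
    by (cases "even (j + l)") (auto simp: minus_one_power_iff split: if_splits)
qed

section \<open>Functions with bounded support\<close>

lemma totally_nonneg_midpoint:
  fixes a :: "int \<Rightarrow> real"
  assumes "totally_nonneg a"
  shows "a i * a (2 * c - i) \<le> (a c)\<^sup>2"
proof -
  consider "i < c" | "i = c" | "i > c" by linarith
  then show ?thesis
  proof cases
    case 1
    then show ?thesis using totally_nonneg_2x2[OF assms, of i c c "2 * c - i"] by (simp add: power2_eq_square)
  next
    case 3
    then show ?thesis using totally_nonneg_2x2[OF assms, of "2 * c - i" c c i]
      by (simp add: power2_eq_square mult.commute)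
  qed (simp add: power2_eq_square)
qed

text \<open>A log-concave positive sequence has no interior dip: at an interior leftmost minimum the
  left neighbour is strictly larger and the right one not smaller, against the midpoint
  inequality.\<close>

lemma totally_nonneg_ge_min_endpoints:
  fixes a :: "int \<Rightarrow> real"
  assumes tn: "totally_nonneg a" and pos: "\<And>i. p \<le> i \<Longrightarrow> i \<le> q \<Longrightarrow> a i > 0" and i: "p \<le> i" "i \<le> q"
  shows "min (a p) (a q) \<le> a i"
proof -
  define \<mu> where "\<mu> = Min (a ` {p..q})"
  have \<mu>: "\<mu> \<le> a k" if "p \<le> k" "k \<le> q" for k
    unfolding \<mu>_def using that by (intro Min_le) auto
  define S where "S = {k \<in> {p..q}. a k = \<mu>}"
  have "\<mu> \<in> a ` {p..q}" unfolding \<mu>_def using i by (intro Min_in) auto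
  then have "S \<noteq> {}" by (auto simp: S_def)
  moreover have "finite S" unfolding S_def by (rule finite_subset[of _ "{p..q}"]) auto
  ultimately have S: "finite S" "S \<noteq> {}" by auto
  define k where "k = Min S"
  have kS: "k \<in> S" unfolding k_def using S by (rule Min_in)
  then have k: "p \<le> k" "k \<le> q" "a k = \<mu>" by (auto simp: S_def)
  have "k = p \<or> k = q"
  proof (rule ccontr)
    assume "\<not> ?thesis"
    with k have pk: "p < k" "k < q" by auto
    have "k - 1 \<notin> S" using Min_le[OF S(1), of "k - 1"] by (auto simp: k_def[symmetric])
    then have 1: "\<mu> < a (k - 1)" using \<mu>[of "k - 1"] pk by (auto simp: S_def)
    have 2: "\<mu> \<le> a (k + 1)" "0 < \<mu>" using \<mu>[of "k + 1"] pos[of k] pk k(3) by auto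
    have "\<mu> * \<mu> < a (k - 1) * a (k + 1)" using 1 2 by (intro mult_less_le_imp_less) auto
    with totally_nonneg_midpoint[OF tn, of "k - 1" k] k(3) show False
      by (simp add: power2_eq_square algebra_simps)
  qed
  with \<mu>[OF i] k(3) show ?thesis by auto
qed

text \<open>The polynomial with coefficients \<open>a\<close> is real-rooted, so after normalisation it is the
  generating function of a sum of \<open>6 l + 2\<close> independent Bernoulli variables, whose variance grows
  only linearly in \<open>l\<close>.  A sequence spread evenly over its support has variance of order
  \<open>l\<^sup>2\<close>.\<close>

lemma finite_totally_nonneg_not_spread:
  fixes a :: "int \<Rightarrow> real"
  assumes tn: "totally_nonneg a" and zero: "\<And>k. k < 0 \<or> k > 6 * int l + 2 \<Longrightarrow> a k = 0"
    and pos: "\<And>k. 0 \<le> k \<Longrightarrow> k \<le> 6 * int l + 2 \<Longrightarrow> a k > 0"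
    and "l \<ge> 1"
    and \<mu>: "\<mu> = min (a (int l)) (a (5 * int l + 2))"
    and X: "X = max (a (3 * int l + 1)) (max (a (int l)) (a (5 * int l + 2)))"
  shows "real l * \<mu> ^ 4 \<le> 54 * X ^ 4"
proof -
  have \<mu>0: "\<mu> > 0" using pos by (auto simp: \<mu>)
  have low: "\<mu> \<le> a i" if "int l \<le> i" "i \<le> 5 * int l + 2" for i
    unfolding \<mu> using that by (intro totally_nonneg_ge_min_endpoints[OF tn] pos) auto
  have X0: "0 \<le> a c" "a c \<le> X" if "c \<in> {int l, 3 * int l + 1, 5 * int l + 2}" for c
    using that totally_nonneg_nonneg[OF tn, of c] by (auto simp: X)
  \<comment> \<open>Reflection of \<open>i\<close> in a suitable one of the three reference points
    lands in the middle stretch, where values are at least \<open>\<mu>\<close>. The midpoint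
    inequality then bounds \<open>a i\<close> by reference values alone.\<close>
  have up: "a i * \<mu> \<le> X\<^sup>2" if i: "0 \<le> i" "i \<le> 6 * int l + 2" for i
  proof -
    obtain c where c: "c \<in> {int l, 3 * int l + 1, 5 * int l + 2}" "int l \<le> 2 * c - i" "2 * c - i \<le> 5 * int l + 2"
    proof -
      consider "i < int l" | "int l \<le> i" "i \<le> 5 * int l + 2" | "5 * int l + 2 < i" by linarith
      then show ?thesis
        by cases (use i that[of "int l"] that[of "3 * int l + 1"] that[of "5 * int l + 2"] in auto)
    qed
    have "a i * \<mu> \<le> a i * a (2 * c - i)"
      using low[OF c(2,3)] pos[OF i] by (intro mult_left_mono) auto
    also have "\<dots> \<le> (a c)\<^sup>2" by (rule totally_nonneg_midpoint[OF tn])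
    also have "\<dots> \<le> X\<^sup>2" using X0[OF c(1)] by (intro power_mono) auto
    finally show ?thesis .
  qed
  define N where "N = 6 * l + 2"
  define b where "b k = a (int k)" for k
  define p where "p = poly_of_seq N b"
  have b: "0 \<le> b k" for k using totally_nonneg_nonneg[OF tn] by (simp add: b_def)
  have bX: "b k * \<mu> \<le> X\<^sup>2" if "k \<le> N" for k
    using up[of "int k"] that by (simp add: b_def N_def)
  have p1: "poly p 1 = (\<Sum>k\<le>N. b k)" by (simp add: p_def poly_of_seq_def poly_sum poly_monom)
  have p1nn: "0 \<le> poly p 1" unfolding p1 by (intro sum_nonneg b)
  have "poly p 1 * \<mu> = (\<Sum>k\<le>N. b k * \<mu>)" by (simp add: p1 sum_distrib_right)
  also have "\<dots> \<le> (\<Sum>k\<le>N. X\<^sup>2)" by (intro sum_mono bX) auto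
  also have "\<dots> = (6 * real l + 3) * X\<^sup>2" by (simp add: N_def)
  also have "\<dots> \<le> (6 * (real l + 1)) * X\<^sup>2" by (intro mult_right_mono) auto
  finally have p1X: "poly p 1 * \<mu> \<le> 6 * (real l + 1) * X\<^sup>2" .
  have "variance_form p \<le> of_nat (degree p) / 4 * (poly p 1)\<^sup>2"
  proof (rule variance_form_le)
    fix z assume "poly (map_poly complex_of_real p) z = 0"
    then show "Im z = 0 \<and> Re z < 0"
      unfolding p_def poly_map_poly_of_seq b_def
      using pos[of 0] by (intro finite_totally_nonneg_roots[OF tn, of N]) (auto simp: N_def intro!: zero)
  qed
  also have "\<dots> \<le> (6 * real l + 6) / 4 * (poly p 1)\<^sup>2"
    using degree_poly_of_seq[of N b] by (intro mult_right_mono divide_right_mono) (auto simp: p_def N_def)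
  finally have V: "variance_form p \<le> (6 * real l + 6) / 4 * (poly p 1)\<^sup>2" .
  \<comment> \<open>Only pairs from two blocks of \<open>l + 1\<close> indices are kept. The blocks
    are at least \<open>2 * l\<close> apart and lie where the values are at least
    \<open>\<mu>\<close>.\<close>
  have "((real l + 1) * (real l + 1)) * (\<mu>\<^sup>2 * (2 * real l)\<^sup>2) =
      (\<Sum>i\<in>{l..2 * l}. \<Sum>j\<in>{4 * l + 2..5 * l + 2}. \<mu> * \<mu> * (2 * real l)\<^sup>2)"
    by (simp add: power2_eq_square of_nat_diff algebra_simps)
  also have "\<dots> \<le> (\<Sum>i\<in>{l..2 * l}. \<Sum>j\<in>{4 * l + 2..5 * l + 2}. b i * b j * (real i - real j)\<^sup>2)"
  proof (intro sum_mono mult_mono)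
    fix i j assume ij: "i \<in> {l..2 * l}" "j \<in> {4 * l + 2..5 * l + 2}"
    show "\<mu> \<le> b i" "\<mu> \<le> b j" using ij by (auto simp: b_def intro!: low)
    have "(2 * real l)\<^sup>2 \<le> (real j - real i)\<^sup>2" using ij by (intro power_mono) auto
    then show "(2 * real l)\<^sup>2 \<le> (real i - real j)\<^sup>2" by (simp add: power2_commute)
  qed (use \<mu>0 b in auto)
  also have "\<dots> \<le> (\<Sum>i\<in>{l..2 * l}. \<Sum>j\<le>N. b i * b j * (real i - real j)\<^sup>2)"
    using b by (intro sum_mono sum_mono2) (auto simp: N_def)
  also have "\<dots> \<le> (\<Sum>i\<le>N. \<Sum>j\<le>N. b i * b j * (real i - real j)\<^sup>2)"
  proof (rule sum_mono2)
    show "{l..2 * l} \<subseteq> {..N}" by (auto simp: N_def)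
    show "0 \<le> (\<Sum>j\<le>N. b i * b j * (real i - real j)\<^sup>2)" for i
      using b by (intro sum_nonneg) auto
  qed auto
  also have "\<dots> = 2 * variance_form p"
    by (simp add: p_def variance_form_poly_of_seq)
  also have "\<dots> \<le> 3 * (real l + 1) * (poly p 1)\<^sup>2" using V by (simp add: field_simps)
  finally have "(real l + 1)\<^sup>2 * (\<mu>\<^sup>2 * (2 * real l)\<^sup>2) \<le> 3 * (real l + 1) * (poly p 1)\<^sup>2"
    by (simp add: power2_eq_square)
  then have "(real l + 1)\<^sup>2 * (\<mu>\<^sup>2 * (2 * real l)\<^sup>2) * \<mu>\<^sup>2 \<le> 3 * (real l + 1) * (poly p 1)\<^sup>2 * \<mu>\<^sup>2"
    by (rule mult_right_mono) auto
  also have "\<dots> = 3 * (real l + 1) * (poly p 1 * \<mu>)\<^sup>2" by (simp add: power_mult_distrib)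
  also have "\<dots> \<le> 3 * (real l + 1) * (6 * (real l + 1) * X\<^sup>2)\<^sup>2"
    using p1X p1nn \<mu>0 by (intro mult_left_mono power_mono) auto
  finally have "(real l + 1)\<^sup>2 * (4 * (real l)\<^sup>2 * \<mu> ^ 4) \<le> (real l + 1)\<^sup>2 * (108 * (real l + 1) * X ^ 4)"
    by (simp add: power2_eq_square power4_eq_xxxx algebra_simps)
  then have "4 * (real l)\<^sup>2 * \<mu> ^ 4 \<le> 108 * (real l + 1) * X ^ 4"
    by (rule mult_left_le_imp_le) (simp add: add_pos_nonneg)
  also have "\<dots> \<le> 108 * (2 * real l) * X ^ 4"
    using \<open>l \<ge> 1\<close> by (intro mult_right_mono mult_left_mono) auto
  finally have "real l * (4 * (real l * \<mu> ^ 4)) \<le> real l * (4 * (54 * X ^ 4))"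
    by (simp add: power2_eq_square algebra_simps)
  then show ?thesis using \<open>l \<ge> 1\<close> by simp
qed

text \<open>Refining the grid leaves three reference samples fixed, so \<open>\<mu>\<close> and
  \<open>X\<close> do not depend on \<open>l\<close> while \<open>real l * \<mu> ^ 4\<close> grows.
  The hypothesis speaks of grids because that is all the class of sequences can supply about
  \<open>F\<close>.\<close>

theorem totally_nonneg_grids_no_bounded_support:
  fixes f :: "real \<Rightarrow> real"
  assumes "a < b" and pos: "\<And>x. a < x \<Longrightarrow> x < b \<Longrightarrow> f x > 0"
    and zero: "\<And>x. x < a \<or> b < x \<Longrightarrow> f x = 0"
    and tn: "\<And>h s. h > 0 \<Longrightarrow> totally_nonneg (\<lambda>k::int. f (h * of_int k + s))"
  shows False
proof -
  define U W V where "U = f (a + (b - a) / 6)" and "W = f (a + (b - a) / 2)" and "V = f (a + 5 * (b - a) / 6)"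
  define \<mu> X where "\<mu> = min U V" and "X = max W (max U V)"
  have "\<mu> > 0" using \<open>a < b\<close> unfolding \<mu>_def U_def V_def by (auto intro!: pos simp: field_simps)
  have bound: "real l * \<mu> ^ 4 \<le> 54 * X ^ 4" if "l \<ge> 1" for l :: nat
  proof -
    \<comment> \<open>\<open>6 * l + 3\<close> cells are sampled at their midpoints, which avoids
      the end points of the support. Counted from 0, the midpoints \<open>l\<close>,
      \<open>3 * l + 1\<close> and \<open>5 * l + 2\<close> lie at the fractions 1/6, 1/2 and 5/6 of
      the interval for every \<open>l\<close>.\<close>
    define h where "h = (b - a) / (6 * real l + 3)"
    have h: "h > 0" "b = a + h * (6 * real l + 3)" using \<open>a < b\<close> by (auto simp: h_def field_simps)
    define \<alpha> where "\<alpha> k = f (h * of_int k + (a + h / 2))" for k :: int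
    have "\<alpha> (int l) = U" "\<alpha> (3 * int l + 1) = W" "\<alpha> (5 * int l + 2) = V"
      unfolding \<alpha>_def U_def V_def W_def h(2) by (rule arg_cong[of _ _ f]; simp add: algebra_simps)+
    moreover have "real l * (min (\<alpha> (int l)) (\<alpha> (5 * int l + 2))) ^ 4 \<le>
      54 * (max (\<alpha> (3 * int l + 1)) (max (\<alpha> (int l)) (\<alpha> (5 * int l + 2)))) ^ 4"
    proof (rule finite_totally_nonneg_not_spread[OF _ _ _ that refl refl])
      show "totally_nonneg \<alpha>" unfolding \<alpha>_def by (rule tn[OF h(1)])
    next
      fix k :: int assume "k < 0 \<or> k > 6 * int l + 2"
      then have "real_of_int k \<le> -1 \<or> real_of_int k \<ge> 6 * real l + 3" by linarith
      then have "h * real_of_int k \<le> h * (-1) \<or> h * real_of_int k \<ge> h * (6 * real l + 3)"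
        using h(1) by (meson mult_left_mono less_imp_le)
      then have "h * real_of_int k + (a + h / 2) < a \<or> b < h * real_of_int k + (a + h / 2)"
      proof
        assume "h * real_of_int k \<le> h * (-1)"
        then show ?thesis using h(1) by (intro disjI1) linarith
      next
        assume "h * real_of_int k \<ge> h * (6 * real l + 3)"
        then show ?thesis using h by (intro disjI2) linarith
      qed
      then show "\<alpha> k = 0" unfolding \<alpha>_def by (rule zero)
    next
      fix k :: int assume "0 \<le> k" "k \<le> 6 * int l + 2"
      then have "0 \<le> real_of_int k" "real_of_int k \<le> 6 * real l + 2" by linarith+
      then have "h * 0 \<le> h * real_of_int k" "h * real_of_int k \<le> h * (6 * real l + 2)"
        using h(1) by (auto intro!: mult_left_mono)
      then show "\<alpha> k > 0" unfolding \<alpha>_def using h by (intro pos) (auto simp: algebra_simps)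
    qed
    ultimately show ?thesis by (simp add: \<mu>_def X_def)
  qed
  obtain l :: nat where l: "54 * X ^ 4 / \<mu> ^ 4 < real l" using reals_Archimedean2 by blast
  have "54 * X ^ 4 < real (Suc l) * \<mu> ^ 4"
    using l \<open>\<mu> > 0\<close> by (simp add: pos_divide_less_eq distrib_right add_pos_nonneg add_strict_increasing)
  with bound[of "Suc l"] show False by simp
qed

section \<open>One-sided test functions\<close>

definition one_sided_exp :: "real \<Rightarrow> real" where
  "one_sided_exp x = (if x < 0 then 0 else exp (- x))"

definition one_sided_exp2 :: "real \<Rightarrow> real" where
  "one_sided_exp2 x = (if x < 0 then 0 else exp (- x) * (1 - exp (- x)))"

text \<open>Six times the convolution of the one-sided exponentials of rates 1, 3 and 4. Skipping
  rate 2 removes the linear term from the bracket.\<close>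

definition one_sided_exp3 :: "real \<Rightarrow> real" where
  "one_sided_exp3 x = (if x < 0 then 0 else exp (- x) * (1 - 3 * exp (- x) ^ 2 + 2 * exp (- x) ^ 3))"

lemma totally_nonneg_tilt:
  assumes "totally_nonneg f"
  shows "totally_nonneg (\<lambda>x::real. exp (c * x) * f x)"
  by (rule totally_nonneg_factor[OF assms, of "\<lambda>x. exp (c * x)" "\<lambda>y. exp (- c * y)"])
     (auto simp: right_diff_distrib exp_diff exp_minus divide_inverse)

lemma one_sided_has_integral:
  fixes f g :: "real \<Rightarrow> real"
  assumes g: "\<And>x. (g has_real_derivative f x) (at x)" and "g 0 = 0" "x \<le> y"
  shows "((\<lambda>t. if t < 0 then 0 else f t) has_integral
    ((if y < 0 then 0 else g y) - (if x < 0 then 0 else g x))) {x..y}"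
proof (rule fundamental_theorem_of_calculus_interior_strong[where S = "{0}"])
  have eq: "(\<lambda>t. if t < 0 then 0 else g t) = (\<lambda>t. g (max 0 t))"
    using \<open>g 0 = 0\<close> by (auto simp: max_def fun_eq_iff)
  have "continuous_on UNIV g"
    using g by (auto intro: DERIV_isCont continuous_at_imp_continuous_on)
  then show "continuous_on {x..y} (\<lambda>t. if t < 0 then 0 else g t)"
    unfolding eq by (auto intro!: continuous_on_compose2[of UNIV g] continuous_intros)
  fix t assume t: "t \<in> {x<..<y} - {0}"
  show "((\<lambda>t. if t < 0 then 0 else g t) has_vector_derivative (if t < 0 then 0 else f t)) (at t)"
  proof (cases "t < 0")
    case True
    have "((\<lambda>t. if t < 0 then 0 else g t) has_real_derivative 0) (at t)"
      by (rule has_field_derivative_transform_within_open[of "\<lambda>_. 0" _ _ "{..<0}"]) (use True in auto)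
    then show ?thesis using True by (simp add: has_real_derivative_iff_has_vector_derivative)
  next
    case False
    have "((\<lambda>t. if t < 0 then 0 else g t) has_real_derivative f t) (at t)"
      by (rule has_field_derivative_transform_within_open[OF g, where S = "{0<..}"]) (use False t in auto)
    then show ?thesis using False by (simp add: has_real_derivative_iff_has_vector_derivative)
  qed
qed (use \<open>x \<le> y\<close> in auto)

lemma totally_nonneg_one_sided_primitive:
  fixes f g :: "real \<Rightarrow> real"
  assumes "totally_nonneg (\<lambda>t. if t < 0 then 0 else f t)"
    and "\<And>x. (g has_real_derivative f x) (at x)" "g 0 = 0"
  shows "totally_nonneg (\<lambda>t. if t < 0 then 0 else g t)"
proof (rule totally_nonneg_primitive[OF assms(1)])
  show "((\<lambda>t. if t < 0 then 0 else f t) has_integral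
      ((if y < 0 then 0 else g y) - (if x < 0 then 0 else g x))) {x..y}" if "x \<le> y" for x y
    by (rule one_sided_has_integral[OF assms(2,3) that])
qed auto

lemma totally_nonneg_one_sided_exp: "totally_nonneg one_sided_exp"
proof -
  have "totally_nonneg (\<lambda>x::real. exp ((-1) * x) * indicator {0..} x)"
    by (intro totally_nonneg_tilt totally_nonneg_indicator_upper) auto
  moreover have "(\<lambda>x::real. exp ((-1) * x) * indicator {0..} x) = one_sided_exp"
    by (auto simp: one_sided_exp_def fun_eq_iff)
  ultimately show ?thesis by simp
qed

lemma totally_nonneg_one_minus_exp:
  "totally_nonneg (\<lambda>x::real. if x < 0 then 0 else 1 - exp (- x))"
  by (rule totally_nonneg_one_sided_primitive[where f = "\<lambda>x. exp (- x)"])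
     (use totally_nonneg_one_sided_exp in \<open>auto simp: one_sided_exp_def[abs_def] intro!: derivative_eq_intros\<close>)

lemma totally_nonneg_one_sided_exp2: "totally_nonneg one_sided_exp2"
proof -
  have "totally_nonneg (\<lambda>x::real. exp ((-1) * x) * (if x < 0 then 0 else 1 - exp (- x)))"
    by (intro totally_nonneg_tilt totally_nonneg_one_minus_exp)
  moreover have "(\<lambda>x::real. exp ((-1) * x) * (if x < 0 then 0 else 1 - exp (- x))) = one_sided_exp2"
    by (auto simp: one_sided_exp2_def fun_eq_iff)
  ultimately show ?thesis by simp
qed

lemma totally_nonneg_one_sided_exp3: "totally_nonneg one_sided_exp3"
proof -
  have "totally_nonneg (\<lambda>x::real. 6 * (exp ((-2) * x) * (if x < 0 then 0 else 1 - exp (- x))))"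
    by (intro totally_nonneg_tilt totally_nonneg_one_minus_exp totally_nonneg_cmult) auto
  moreover have "(\<lambda>x::real. 6 * (exp ((-2) * x) * (if x < 0 then 0 else 1 - exp (- x)))) =
      (\<lambda>x. if x < 0 then 0 else 6 * exp (- 2 * x) - 6 * exp (- 3 * x))"
    by (auto simp: fun_eq_iff algebra_simps exp_add[symmetric])
  ultimately have "totally_nonneg (\<lambda>x::real. if x < 0 then 0 else 6 * exp (- 2 * x) - 6 * exp (- 3 * x))"
    by simp
  then have "totally_nonneg (\<lambda>x::real. if x < 0 then 0 else 1 - 3 * exp (- 2 * x) + 2 * exp (- 3 * x))"
    by (rule totally_nonneg_one_sided_primitive) (auto intro!: derivative_eq_intros)
  then have "totally_nonneg (\<lambda>x::real. exp ((-1) * x) *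
      (if x < 0 then 0 else 1 - 3 * exp (- 2 * x) + 2 * exp (- 3 * x)))"
    by (rule totally_nonneg_tilt)
  moreover have "(\<lambda>x::real. exp ((-1) * x) * (if x < 0 then 0 else 1 - 3 * exp (- 2 * x) + 2 * exp (- 3 * x)))
      = one_sided_exp3"
    by (auto simp: one_sided_exp3_def fun_eq_iff exp_of_nat_mult[symmetric])
  ultimately show ?thesis by simp
qed

lemma integrable_one_sided_exp_scaled:
  assumes "k > 0"
  shows "integrable lebesgue (\<lambda>x::real. if x < 0 then 0 else exp (- k * x))"
proof -
  have "(\<lambda>x::real. exp (- k * x)) absolutely_integrable_on {0..}"
    using integrable_on_exp_minus_to_infinity[OF assms, of 0]
    by (intro nonnegative_absolutely_integrable_1) auto
  then have "integrable lebesgue (\<lambda>x::real. indicator {0..} x *\<^sub>R exp (- k * x))"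
    by (simp add: set_integrable_def)
  moreover have "(\<lambda>x::real. indicator {0..} x *\<^sub>R exp (- k * x)) = (\<lambda>x. if x < 0 then 0 else exp (- k * x))"
    by (auto simp: fun_eq_iff)
  ultimately show ?thesis by simp
qed

lemma one_sided_test_functions:
  assumes "\<phi> \<in> {one_sided_exp, one_sided_exp2, one_sided_exp3}" "K > 0"
  shows "polya_frequency_function (\<lambda>x. K * \<phi> x) \<and> one_sided_function (\<lambda>x. K * \<phi> x)"
proof -
  define e where "e k x = (if x < 0 then 0 else exp (- k * x))" for k x :: real
  have e: "integrable lebesgue (e k)" if "k > 0" for k
    using integrable_one_sided_exp_scaled[OF that] by (simp add: e_def[abs_def])
  have eq: "one_sided_exp = e 1" "one_sided_exp2 = (\<lambda>x. e 1 x - e 2 x)"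
    "one_sided_exp3 = (\<lambda>x. e 1 x - 3 * e 3 x + 2 * e 4 x)"
    by (auto simp: one_sided_exp_def one_sided_exp2_def one_sided_exp3_def e_def fun_eq_iff
        exp_of_nat_mult[symmetric] exp_add[symmetric] algebra_simps)
  have "integrable lebesgue one_sided_exp"
    unfolding eq(1) by (rule e) simp
  moreover have "integrable lebesgue one_sided_exp2"
    unfolding eq(2) by (intro Bochner_Integration.integrable_diff e) auto
  moreover have "integrable lebesgue one_sided_exp3"
    unfolding eq(3) by (intro Bochner_Integration.integrable_diff Bochner_Integration.integrable_add
        integrable_mult_right e) auto
  ultimately have int: "integrable lebesgue \<phi>"
    using assms(1) by auto
  have pos: "\<phi> x > 0" if "x > 0" for x
  proof -
    have q: "0 < exp (- x)" "exp (- x) < 1" using that by auto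
    have "1 - 3 * q ^ 2 + 2 * q ^ 3 = (1 - q) ^ 2 * (1 + 2 * q)" for q :: real
      by (simp add: power2_eq_square power3_eq_cube algebra_simps)
    then have "one_sided_exp3 x > 0" using that q
      by (simp add: one_sided_exp3_def add_pos_pos)
    then show ?thesis using assms(1) that q by (auto simp: one_sided_exp_def one_sided_exp2_def)
  qed
  have tn: "totally_nonneg \<phi>"
    using assms(1) totally_nonneg_one_sided_exp totally_nonneg_one_sided_exp2 totally_nonneg_one_sided_exp3 by auto
  have "polya_frequency_function (\<lambda>x. K * \<phi> x)"
    unfolding polya_frequency_function_def
  proof (intro conjI)
    show "\<exists>x y. x \<noteq> y \<and> K * \<phi> x \<noteq> 0 \<and> K * \<phi> y \<noteq> 0"
      using pos[of 1] pos[of 2] assms(2) by (intro exI[of _ 1] exI[of _ 2]) auto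
  qed (use totally_nonneg_cmult[OF tn, of K] int assms(2) in auto)
  moreover have "\<forall>x<0. \<phi> x = 0"
    using assms(1) by (auto simp: one_sided_exp_def one_sided_exp2_def one_sided_exp3_def)
  then have "one_sided_function (\<lambda>x. K * \<phi> x)"
    unfolding one_sided_function_def by (intro exI[of _ 0]) auto
  ultimately show ?thesis by blast
qed

section \<open>Splitting off poles\<close>

text \<open>Splitting off a pole subtracts a multiple of the row one index earlier, which belongs to
  the same minor only when rows are consecutive. This weaker property, with arbitrary columns, is
  the one that can be iterated.\<close>

definition consecutive_rows_tn :: "(int \<Rightarrow> real) \<Rightarrow> bool" where
  "consecutive_rows_tn a \<longleftrightarrow> (\<forall>n x0 y. strict_mono_on {..<n} y \<longrightarrow>
     ddet n (\<lambda>i j. a (x0 + int i - y j)) \<ge> 0)"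

lemma totally_nonneg_imp_consecutive_rows_tn:
  assumes "totally_nonneg a"
  shows "consecutive_rows_tn a"
  unfolding consecutive_rows_tn_def
proof (intro allI impI)
  fix n x0 and y :: "nat \<Rightarrow> int" assume "strict_mono_on {..<n} y"
  then show "0 \<le> ddet n (\<lambda>i j. a (x0 + int i - y j))"
    using totally_nonnegD[OF assms, of n "\<lambda>i. x0 + int i" y] by (auto simp: strict_mono_on_def)
qed

lemma consecutive_rows_tn_nonneg:
  assumes "consecutive_rows_tn a"
  shows "a k \<ge> 0"
proof -
  have "strict_mono_on {..<1::nat} (\<lambda>_. 0::int)" by (rule strict_mono_onI) auto
  with assms have "0 \<le> ddet 1 (\<lambda>i j. a (k + int i - 0))"
    unfolding consecutive_rows_tn_def by blast
  then show ?thesis by (simp add: ddet_1)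
qed

text \<open>This is the Edrei--Schoenberg device of splitting off a pole of the generating function: a column
  sent to \<open>-\<infinity>\<close> becomes geometric with ratio \<open>\<rho>\<close>, and eliminating it replaces
  \<open>a\<close> by \<open>b\<close> in the remaining minor.\<close>

lemma consecutive_rows_tn_split_pole:
  assumes a: "consecutive_rows_tn a"
    and pos: "eventually (\<lambda>n. a (int n) > 0) sequentially"
    and ratio: "(\<lambda>n. a (int n + 1) / a (int n)) \<longlonglongrightarrow> \<rho>"
  shows "consecutive_rows_tn (\<lambda>k. a k - \<rho> * a (k - 1))"
  unfolding consecutive_rows_tn_def
proof (intro allI impI)
  fix n x0 and y :: "nat \<Rightarrow> int" assume y: "strict_mono_on {..<n} y"
  define b where "b k = a k - \<rho> * a (k - 1)" for k
  have pow: "(\<lambda>t. a (int t + int i) / a (int t)) \<longlonglongrightarrow> \<rho> ^ i" for i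
  proof (induction i)
    case 0
    have "eventually (\<lambda>t. a (int t + int 0) / a (int t) = 1) sequentially"
      using pos by eventually_elim simp
    then show ?case using tendsto_eventually by force
  next
    case (Suc i)
    have "(\<lambda>t. a (int (t + i) + 1) / a (int (t + i))) \<longlonglongrightarrow> \<rho>"
      using ratio by (rule LIMSEQ_ignore_initial_segment)
    from tendsto_mult[OF this Suc.IH]
    have "(\<lambda>t. (a (int (t + i) + 1) / a (int (t + i))) * (a (int t + int i) / a (int t))) \<longlonglongrightarrow> \<rho> ^ Suc i"
      by simp
    moreover have "eventually (\<lambda>t. (a (int (t + i) + 1) / a (int (t + i))) * (a (int t + int i) / a (int t)) =
        a (int t + int (Suc i)) / a (int t)) sequentially"
      using eventually_all_ge_at_top[OF pos] 
    proof eventually_elim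
      case (elim t)
      then have "a (int (t + i)) > 0" using le_add1 by blast
      then show ?case by (simp add: field_simps)
    qed
    ultimately show ?case by (rule Lim_transform_eventually)
  qed
  have b0: "(\<lambda>t. b (int t + int i) / a (int t)) \<longlonglongrightarrow> 0" if "i > 0" for i
  proof -
    from that obtain l where i: "i = Suc l" by (rule gr0_implies_Suc[THEN exE])
    have "(\<lambda>t. a (int t + int i) / a (int t) - \<rho> * (a (int t + int l) / a (int t))) \<longlonglongrightarrow> \<rho> ^ i - \<rho> * \<rho> ^ l"
      by (intro tendsto_intros pow)
    moreover have "a (int t + int i) / a (int t) - \<rho> * (a (int t + int l) / a (int t)) = b (int t + int i) / a (int t)" for t
      by (simp add: b_def i diff_divide_distrib)
    ultimately show ?thesis by (simp add: i)
  qed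
  \<comment> \<open>The differenced minor with a further row \<open>x0 - 1\<close> on top and a
    further column \<open>x0 - 1 - t\<close> on the left. Only column 0 depends on \<open>t\<close>,
    so the cofactors \<open>C\<close> can be taken at \<open>t = 0\<close>.\<close>
  define R where "R t i j = (if j = 0 then (if i = 0 then a (int t) else b (int t + int i))
    else (if i = 0 then a (x0 - 1 - y (j - 1)) else b (x0 - 1 + int i - y (j - 1))))" for t i j
  define C where "C i = (-1) ^ i * ddet n (\<lambda>p q. R 0 (insert_index i p) (Suc q))" for i
  have expand: "ddet (Suc n) (R t) = (\<Sum>i<Suc n. R t i 0 * C i)" for t
    unfolding ddet_col[OF zero_less_Suc] C_def
    by (intro sum.cong refl) (auto simp: R_def intro!: ddet_cong)
  have "eventually (\<lambda>t. ddet (Suc n) (R t) \<ge> 0) sequentially"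
  proof -
    define Y where "Y = Max (insert 0 ((\<lambda>j. x0 - 1 - y j) ` {..<n}))"
    have Y: "x0 - 1 - y j \<le> Y" if "j < n" for j
      unfolding Y_def using that by (intro Max_ge) auto
    show ?thesis
      using eventually_gt_at_top[of "nat Y"]
    proof eventually_elim
      case (elim t)
      have "Y < int t" using elim by linarith
      define y' where "y' j = (if j = 0 then x0 - 1 - int t else y (j - 1))" for j
      have "y' i < y' j" if "i < j" "j < Suc n" for i j
      proof -
        have "j - 1 < n" using that by arith
        then show ?thesis
          using that \<open>Y < int t\<close> Y[of "j - 1"] strict_mono_onD[OF y, of "i - 1" "j - 1"] by (auto simp: y'_def)
      qed
      then have "strict_mono_on {..<Suc n} y'" by (auto simp: strict_mono_on_def)
      then have "0 \<le> ddet (Suc n) (\<lambda>i j. a (x0 - 1 + int i - y' j))"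
        using a unfolding consecutive_rows_tn_def by blast
      also have "\<dots> = ddet (Suc n) (\<lambda>i j. a (x0 - 1 + int i - y' j) -
          (if i = 0 then 0 else \<rho> * a (x0 - 1 + int (i - 1) - y' j)))"
        by (rule ddet_row_differences[symmetric])
      also have "\<dots> = ddet (Suc n) (R t)"
        by (rule ddet_cong) (auto simp: R_def y'_def b_def of_nat_diff algebra_simps)
      finally show ?case .
    qed
  qed
  \<comment> \<open>Divided by \<open>a (int t)\<close>, column 0 tends to the first unit vector,
    and only the cofactor \<open>C 0\<close>, the wanted minor of \<open>b\<close>,
    survives.\<close>
  with pos have "eventually (\<lambda>t. 0 \<le> C 0 + (\<Sum>i<n. b (int t + int (Suc i)) / a (int t) * C (Suc i))) sequentially"
  proof eventually_elim
    case (elim t)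
    have "ddet (Suc n) (R t) / a (int t) = C 0 + (\<Sum>i<n. b (int t + int (Suc i)) / a (int t) * C (Suc i))"
      using elim(1) unfolding expand sum.lessThan_Suc_shift
      by (simp add: R_def add_divide_distrib sum_divide_distrib)
    then show ?case using elim by (metis divide_nonneg_pos)
  qed
  moreover have "(\<lambda>t. C 0 + (\<Sum>i<n. b (int t + int (Suc i)) / a (int t) * C (Suc i))) \<longlonglongrightarrow> C 0 + (\<Sum>i<n. 0 * C (Suc i))"
    by (intro tendsto_intros b0) auto
  ultimately have "0 \<le> C 0 + (\<Sum>i<n. 0 * C (Suc i))"
    by (intro tendsto_lowerbound) auto
  also have "\<dots> = ddet n (\<lambda>i j. b (x0 + int i - y j))"
    by (simp add: C_def) (intro ddet_cong, auto simp: R_def)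
  finally show "0 \<le> ddet n (\<lambda>i j. a (x0 + int i - y j) - \<rho> * a (x0 + int i - y j - 1))"
    by (simp add: b_def)
qed

section \<open>Expansions sampled at powers of one half\<close>

lemma halving_sequence_asymptotics:
  fixes G :: "real \<Rightarrow> real"
  assumes lim: "((\<lambda>t. G t / t ^ m) \<longlongrightarrow> L) (at_right 0)" and "L > 0"
    and s: "eventually (\<lambda>n. s (int n) = G ((1 / 2) ^ n)) sequentially"
  shows "eventually (\<lambda>n. s (int n) > 0) sequentially"
    and "(\<lambda>n. s (int n + 1) / s (int n)) \<longlonglongrightarrow> (1 / 2) ^ m"
proof -
  define r where "r n = (1 / 2 :: real) ^ n" for n
  have "filterlim r (at_right 0) sequentially"
    unfolding r_def by real_asymp
  from filterlim_compose[OF lim this]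
  have l: "(\<lambda>n. G (r n) / r n ^ m) \<longlonglongrightarrow> L" .
  then have "eventually (\<lambda>n. G (r n) / r n ^ m > 0) sequentially"
    using \<open>L > 0\<close> by (rule order_tendstoD)
  with s show "eventually (\<lambda>n. s (int n) > 0) sequentially"
    by eventually_elim (auto simp: r_def zero_less_divide_iff)
  have "(\<lambda>n. (G (r (Suc n)) / r (Suc n) ^ m) / (G (r n) / r n ^ m) * (1 / 2) ^ m) \<longlonglongrightarrow> L / L * (1 / 2) ^ m"
    using l LIMSEQ_Suc[OF l] \<open>L > 0\<close> by (intro tendsto_intros) auto
  moreover have "(G (r (Suc n)) / r (Suc n) ^ m) / (G (r n) / r n ^ m) * (1 / 2) ^ m = G (r (Suc n)) / G (r n)" for n
  proof -
    have "r (Suc n) ^ m = r n ^ m * (1 / 2) ^ m" unfolding r_def power_Suc power_mult_distrib by (rule mult.commute)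
    moreover have "r n > 0" by (simp add: r_def)
    ultimately show ?thesis by (simp add: field_simps)
  qed
  ultimately have "(\<lambda>n. G (r (Suc n)) / G (r n)) \<longlonglongrightarrow> (1 / 2) ^ m" using \<open>L > 0\<close> by simp
  moreover have "eventually (\<lambda>n. G (r (Suc n)) / G (r n) = s (int n + 1) / s (int n)) sequentially"
  proof -
    have "eventually (\<lambda>n. s (int (Suc n)) = G (r (Suc n))) sequentially"
      using s unfolding r_def by (rule eventually_sequentially_Suc[THEN iffD2])
    with s show ?thesis by eventually_elim (simp add: r_def add.commute)
  qed
  ultimately show "(\<lambda>n. s (int n + 1) / s (int n)) \<longlonglongrightarrow> (1 / 2) ^ m"
    by (rule Lim_transform_eventually)
qed

text \<open>A leading term \<open>L * t ^ m\<close> at \<open>t = (1 / 2) ^ n\<close> is a pole of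
  ratio \<open>(1 / 2) ^ m\<close>, and one step back in the index doubles \<open>t\<close>.\<close>

lemma consecutive_rows_tn_split_pole_halving:
  fixes G :: "real \<Rightarrow> real"
  assumes s: "consecutive_rows_tn s"
    and lim: "((\<lambda>t. G t / t ^ m) \<longlongrightarrow> L) (at_right 0)" "L > 0"
    and G: "eventually (\<lambda>n. s (int n) = G ((1 / 2) ^ n)) sequentially"
  shows "\<exists>s'. consecutive_rows_tn s' \<and>
    eventually (\<lambda>n. s' (int n) = G ((1 / 2) ^ n) - (1 / 2) ^ m * G (2 * (1 / 2) ^ n)) sequentially"
proof (intro exI conjI)
  show "consecutive_rows_tn (\<lambda>k. s k - (1 / 2) ^ m * s (k - 1))"
    using halving_sequence_asymptotics[OF lim G] by (intro consecutive_rows_tn_split_pole s)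
  have "eventually (\<lambda>n. s (int (Suc n)) - (1 / 2) ^ m * s (int (Suc n) - 1) =
      G ((1 / 2) ^ (Suc n)) - (1 / 2) ^ m * G (2 * (1 / 2) ^ (Suc n))) sequentially"
    using G eventually_sequentially_Suc[THEN iffD2, OF G] by eventually_elim simp
  then show "eventually (\<lambda>n. s (int n) - (1 / 2) ^ m * s (int n - 1) =
      G ((1 / 2) ^ n) - (1 / 2) ^ m * G (2 * (1 / 2) ^ n)) sequentially"
    by (rule eventually_sequentially_Suc[THEN iffD1])
qed

lemma consecutive_rows_tn_halving_limit_nonneg:
  fixes G :: "real \<Rightarrow> real"
  assumes s: "consecutive_rows_tn s"
    and lim: "((\<lambda>t. G t / t ^ m) \<longlongrightarrow> L) (at_right 0)"
    and G: "eventually (\<lambda>n. s (int n) = G ((1 / 2) ^ n)) sequentially"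
  shows "L \<ge> 0"
proof -
  have "filterlim (\<lambda>n. (1 / 2 :: real) ^ n) (at_right 0) sequentially" by real_asymp
  from filterlim_compose[OF lim this]
  have "(\<lambda>n. G ((1 / 2) ^ n) / ((1 / 2) ^ n) ^ m) \<longlonglongrightarrow> L" .
  moreover have "eventually (\<lambda>n. G ((1 / 2) ^ n) / ((1 / 2) ^ n) ^ m \<ge> 0) sequentially"
    using G by eventually_elim (metis consecutive_rows_tn_nonneg s divide_nonneg_nonneg zero_le_power zero_le_divide_1_iff zero_le_numeral)
  ultimately show ?thesis by (intro tendsto_lowerbound) auto
qed

text \<open>The coefficient of \<open>t ^ 2\<close> is \<open>\<alpha> * (\<alpha> - 1) / 2\<close>,
  and the two splittings multiply it by \<open>(1 - 4) * (1 - 2) = 3\<close>. The resulting limit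
  would have to be non-negative.\<close>

lemma no_power_below_one:
  assumes s: "consecutive_rows_tn s"
    and s_eq: "eventually (\<lambda>n. s (int n) = (1 - (1 / 2) ^ n) powr \<alpha>) sequentially"
    and \<alpha>: "0 < \<alpha>" "\<alpha> < 1"
  shows False
proof -
  define G where "G t = (1 - t) powr \<alpha>" for t :: real
  define G1 where "G1 t = G t - (1 / 2) ^ 0 * G (2 * t)" for t
  define G2 where "G2 t = G1 t - (1 / 2) ^ 1 * G1 (2 * t)" for t
  have one: "0 < (1::real)" by simp
  have lim: "((\<lambda>t. G t / t ^ 0) \<longlongrightarrow> 1) (at_right 0)" unfolding G_def by real_asymp
  obtain s1 where s1: "consecutive_rows_tn s1" "eventually (\<lambda>n. s1 (int n) = G1 ((1 / 2) ^ n)) sequentially"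
    using consecutive_rows_tn_split_pole_halving[where G = G, OF s lim one s_eq[folded G_def]]
    unfolding G1_def by blast
  have lim: "((\<lambda>t. G1 t / t ^ 1) \<longlongrightarrow> \<alpha>) (at_right 0)" unfolding G1_def G_def by real_asymp
  obtain s2 where s2: "consecutive_rows_tn s2" "eventually (\<lambda>n. s2 (int n) = G2 ((1 / 2) ^ n)) sequentially"
    using consecutive_rows_tn_split_pole_halving[where G = G1, OF s1(1) lim \<alpha>(1) s1(2)]
    unfolding G2_def by blast
  have "((\<lambda>t. G2 t / t ^ 2) \<longlongrightarrow> 3 * \<alpha> * (\<alpha> - 1) / 2) (at_right 0)"
    unfolding G2_def G1_def G_def by real_asymp
  from consecutive_rows_tn_halving_limit_nonneg[OF s2(1) this s2(2)]
  have "0 \<le> \<alpha> * (\<alpha> - 1)" by simp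
  then show False using \<alpha> by (simp add: zero_le_mult_iff)
qed

text \<open>The coefficient of \<open>t ^ 4\<close> is
  \<open>\<beta> = 9 * \<alpha> * (\<alpha> - 1) / 2\<close>, and the three splittings multiply it
  by \<open>(1 - 16) * (1 - 4) * (1 - 2) = - 45\<close>. The leading coefficients
  \<open>9 * \<alpha>\<close> and \<open>14 * \<alpha>\<close> met on the way arise from
  \<open>- 3 * \<alpha>\<close> and \<open>2 * \<alpha>\<close> in the same manner.\<close>

lemma no_power_above_one:
  assumes s: "consecutive_rows_tn s"
    and s_eq: "eventually (\<lambda>n. s (int n) = (1 - 3 * ((1 / 2) ^ n) ^ 2 + 2 * ((1 / 2) ^ n) ^ 3) powr \<alpha>) sequentially"
    and \<alpha>: "1 < \<alpha>"
  shows False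
proof -
  define G where "G t = (1 - 3 * t ^ 2 + 2 * t ^ 3) powr \<alpha>" for t :: real
  define G1 where "G1 t = G t - (1 / 2) ^ 0 * G (2 * t)" for t
  define G2 where "G2 t = G1 t - (1 / 2) ^ 2 * G1 (2 * t)" for t
  define G3 where "G3 t = G2 t - (1 / 2) ^ 3 * G2 (2 * t)" for t
  have pos: "0 < 9 * \<alpha>" "0 < 14 * \<alpha>" using \<alpha> by auto
  have one: "0 < (1::real)" by simp
  have lim: "((\<lambda>t. G t / t ^ 0) \<longlongrightarrow> 1) (at_right 0)" unfolding G_def by real_asymp
  obtain s1 where s1: "consecutive_rows_tn s1" "eventually (\<lambda>n. s1 (int n) = G1 ((1 / 2) ^ n)) sequentially"
    using consecutive_rows_tn_split_pole_halving[where G = G, OF s lim one s_eq[folded G_def]]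
    unfolding G1_def by blast
  have lim: "((\<lambda>t. G1 t / t ^ 2) \<longlongrightarrow> 9 * \<alpha>) (at_right 0)" unfolding G1_def G_def by real_asymp
  obtain s2 where s2: "consecutive_rows_tn s2" "eventually (\<lambda>n. s2 (int n) = G2 ((1 / 2) ^ n)) sequentially"
    using consecutive_rows_tn_split_pole_halving[where G = G1, OF s1(1) lim pos(1) s1(2)]
    unfolding G2_def by blast
  \<comment> \<open>The fourth-order remainder is carried along as a function, so that only
    \<open>e\<close> itself has to be expanded; the last limit combines its values at
    \<open>t\<close>, \<open>2 * t\<close>, \<open>4 * t\<close> and \<open>8 * t\<close>.\<close>
  define e where "e t = (G t - 1 + 3 * \<alpha> * t ^ 2 - 2 * \<alpha> * t ^ 3) / t ^ 4" for t
  define E1 where "E1 t = e t - 16 * e (2 * t)" for t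
  define E2 where "E2 t = E1 t - 4 * E1 (2 * t)" for t
  have G: "G t = 1 - 3 * \<alpha> * t ^ 2 + 2 * \<alpha> * t ^ 3 + t ^ 4 * e t" if "t > 0" for t
    using that by (simp add: e_def)
  have G2: "G2 t = 14 * \<alpha> * t ^ 3 + t ^ 4 * E2 t" if "t > 0" for t
    using that by (simp add: G2_def G1_def G E1_def E2_def power_mult_distrib power_divide algebra_simps)
  have G3: "G3 t = t ^ 4 * (E2 t - 2 * E2 (2 * t))" if "t > 0" for t
    using that by (simp add: G3_def G2 power_mult_distrib power_divide algebra_simps)
  have double: "filterlim (\<lambda>t::real. 2 * t) (at_right 0) (at_right 0)" by real_asymp
  define \<beta> where "\<beta> = 9 * \<alpha> * (\<alpha> - 1) / 2"
  have e: "(e \<longlongrightarrow> \<beta>) (at_right 0)" unfolding e_def[abs_def] G_def \<beta>_def by real_asymp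
  have E1: "(E1 \<longlongrightarrow> \<beta> - 16 * \<beta>) (at_right 0)"
    unfolding E1_def[abs_def] by (intro tendsto_intros e filterlim_compose[OF e double])
  have E2: "(E2 \<longlongrightarrow> (\<beta> - 16 * \<beta>) - 4 * (\<beta> - 16 * \<beta>)) (at_right 0)"
    unfolding E2_def[abs_def] by (intro tendsto_intros E1 filterlim_compose[OF E1 double])
  have "((\<lambda>t. 14 * \<alpha> + t * E2 t) \<longlongrightarrow> 14 * \<alpha> + 0 * ((\<beta> - 16 * \<beta>) - 4 * (\<beta> - 16 * \<beta>))) (at_right 0)"
    by (intro tendsto_intros E2)
  moreover have "eventually (\<lambda>t. 14 * \<alpha> + t * E2 t = G2 t / t ^ 3) (at_right 0)"
    using eventually_at_right_less[of "0::real"] by eventually_elim (simp add: G2 field_simps power4_eq_xxxx power3_eq_cube)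
  ultimately have "((\<lambda>t. G2 t / t ^ 3) \<longlongrightarrow> 14 * \<alpha> + 0 * ((\<beta> - 16 * \<beta>) - 4 * (\<beta> - 16 * \<beta>))) (at_right 0)"
    by (rule Lim_transform_eventually)
  then have lim: "((\<lambda>t. G2 t / t ^ 3) \<longlongrightarrow> 14 * \<alpha>) (at_right 0)" by simp
  obtain s3 where s3: "consecutive_rows_tn s3" "eventually (\<lambda>n. s3 (int n) = G3 ((1 / 2) ^ n)) sequentially"
    using consecutive_rows_tn_split_pole_halving[where G = G2, OF s2(1) lim pos(2) s2(2)]
    unfolding G3_def by blast
  have "((\<lambda>t. E2 t - 2 * E2 (2 * t)) \<longlongrightarrow> ((\<beta> - 16 * \<beta>) - 4 * (\<beta> - 16 * \<beta>)) -
      2 * ((\<beta> - 16 * \<beta>) - 4 * (\<beta> - 16 * \<beta>))) (at_right 0)"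
    by (intro tendsto_intros E2 filterlim_compose[OF E2 double])
  moreover have "eventually (\<lambda>t. E2 t - 2 * E2 (2 * t) = G3 t / t ^ 4) (at_right 0)"
    using eventually_at_right_less[of "0::real"] by eventually_elim (simp add: G3)
  ultimately have "((\<lambda>t. G3 t / t ^ 4) \<longlongrightarrow> ((\<beta> - 16 * \<beta>) - 4 * (\<beta> - 16 * \<beta>)) -
      2 * ((\<beta> - 16 * \<beta>) - 4 * (\<beta> - 16 * \<beta>))) (at_right 0)"
    by (rule Lim_transform_eventually)
  from consecutive_rows_tn_halving_limit_nonneg[OF s3(1) this s3(2)]
  have "\<alpha> * (\<alpha> - 1) \<le> 0" by (simp add: \<beta>_def)
  then show False using \<alpha> by (simp add: mult_le_0_iff)
qed

section \<open>Functions preserving the test functions\<close>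

text \<open>Monotonicity between the integers around \<open>n * x\<close> bounds
  \<open>n * (A x - A 1 * x)\<close> by \<open>A 1\<close>, uniformly in \<open>n\<close>.\<close>

lemma additive_mono_imp_linear:
  fixes A :: "real \<Rightarrow> real"
  assumes add: "\<And>x y. A (x + y) = A x + A y" and mono: "mono A"
  shows "A x = A 1 * x"
proof -
  have A0: "A 0 = 0" using add[of 0 0] by simp
  have nat: "A (real n * x) = real n * A x" for n x
    by (induction n) (auto simp: A0 add distrib_right)
  have minus: "A (- x) = - A x" for x using add[of x "- x"] A0 by simp
  have int: "A (of_int k) = of_int k * A 1" for k
  proof (cases "k \<ge> 0")
    case True
    then show ?thesis using nat[of "nat k" 1] by simp
  next
    case False
    then show ?thesis using nat[of "nat (- k)" 1] minus[of "- of_int k"] by simp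
  qed
  have bound: "real n * \<bar>A x - A 1 * x\<bar> \<le> A 1" for n
  proof -
    define k where "k = \<lfloor>real n * x\<rfloor>"
    have k: "of_int k \<le> real n * x" "real n * x \<le> of_int k + 1" unfolding k_def by linarith+
    have 1: "of_int k * A 1 \<le> real n * A x"
      using monoD[OF mono k(1)] by (simp add: int nat)
    have 2: "real n * A x \<le> (of_int k + 1) * A 1"
      using monoD[OF mono k(2)] int[of "k + 1"] by (simp add: nat)
    have "0 \<le> A 1" using monoD[OF mono, of 0 1] A0 by simp
    then have "of_int k * A 1 \<le> real n * x * A 1" "real n * x * A 1 \<le> (of_int k + 1) * A 1"
      using k by (intro mult_right_mono; simp)+
    with 1 2 have "\<bar>real n * A x - real n * x * A 1\<bar> \<le> A 1"
      by (simp add: abs_le_iff algebra_simps)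
    moreover have "real n * A x - real n * x * A 1 = real n * (A x - A 1 * x)" by (simp add: algebra_simps)
    ultimately show ?thesis by (simp add: abs_mult)
  qed
  show ?thesis
  proof (rule ccontr)
    assume "A x \<noteq> A 1 * x"
    then have "0 < \<bar>A x - A 1 * x\<bar>" by simp
    then obtain n where "A 1 < real n * \<bar>A x - A 1 * x\<bar>" using reals_Archimedean3 by blast
    with bound[of n] show False by linarith
  qed
qed

text \<open>Successive ratios decrease, so \<open>n\<close> steps gain at most the
  \<open>n\<close>-th power of the first. Turned around, known values \<open>n\<close> steps apart
  control the first step of a fine mesh.\<close>

lemma log_concave_ratio_root:
  fixes b :: "int \<Rightarrow> real"
  assumes tn: "totally_nonneg b" and pos: "\<And>k. m \<le> k \<Longrightarrow> b k > 0" and "n > 0"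
  shows "root n (b (m + int n) / b m) \<le> b (m + 1) / b m"
proof -
  have "b (m + int k) / b m \<le> (b (m + 1) / b m) ^ k" for k
  proof (induction k)
    case (Suc k)
    have "b m * b (m + int k + 1) \<le> b (m + 1) * b (m + int k)"
    proof (cases "k = 0")
      case False
      then show ?thesis by (intro totally_nonneg_2x2[OF tn]) auto
    qed (simp add: mult.commute)
    then have "b (m + int (Suc k)) / b m \<le> (b (m + 1) / b m) * (b (m + int k) / b m)"
      using pos[of m] by (simp add: field_simps)
    also have "\<dots> \<le> (b (m + 1) / b m) * (b (m + 1) / b m) ^ k"
      using Suc.IH pos[of m] pos[of "m + 1"] by (intro mult_left_mono) auto
    finally show ?case by simp
  qed (use pos[of m] in auto)
  from this[of n] have "root n (b (m + int n) / b m) \<le> root n ((b (m + 1) / b m) ^ n)"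
    using \<open>n > 0\<close> by simp
  also have "\<dots> = b (m + 1) / b m"
    using \<open>n > 0\<close> pos[of m] pos[of "m + 1"] by (intro real_root_power_cancel) auto
  finally show ?thesis .
qed

context
  fixes F :: "real \<Rightarrow> real"
  assumes F0: "F 0 = 0"
    and tn: "\<And>\<phi> K h s. \<phi> \<in> {one_sided_exp, one_sided_exp2, one_sided_exp3} \<Longrightarrow> K > 0 \<Longrightarrow> h > 0 \<Longrightarrow>
      totally_nonneg (\<lambda>k::int. F (K * \<phi> (h * of_int k + s)))"
begin

lemma F_nonneg: assumes "x > 0" shows "F x \<ge> 0"
  using totally_nonneg_nonneg[OF tn[of one_sided_exp x 1 0], of 0] assms
  by (simp add: one_sided_exp_def)

text \<open>The function \<open>K * q * (1 - q)\<close> is placed on a three-point grid with values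
  \<open>A\<close>, \<open>C\<close>, \<open>A\<close>, and the midpoint inequality is applied after
  composing with \<open>F\<close>.\<close>

lemma F_mono:
  assumes "0 < A" "A \<le> C"
  shows "F A \<le> F C"
proof (cases "A = C")
  case False
  \<comment> \<open>At the ends \<open>q\<close> and \<open>1 - q\<close> are exchanged; at the
    midpoint \<open>q\<close> is their geometric mean \<open>m\<close>. The values are in the ratio
    \<open>m\<^sup>2\<close> to \<open>m * (1 - m)\<close>, which is \<open>A\<close> to
    \<open>C\<close> for this \<open>m\<close>.\<close>
  define m where "m = A / (A + C)"
  have m: "0 < m" "m < 1 / 2" using assms False by (auto simp: m_def field_simps)
  define d where "d = sqrt (1 / 4 - m\<^sup>2)"
  have "m * m < (1 / 2) * (1 / 2)" using m by (intro mult_strict_mono) auto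
  then have d2: "d * d = 1 / 4 - m\<^sup>2" "0 < d"
    by (auto simp: d_def power2_eq_square)
  have "d < 1 / 2"
  proof (rule ccontr)
    assume "\<not> ?thesis"
    then have "(1 / 2) * (1 / 2) \<le> d * d" by (intro mult_mono) auto
    with d2 m show False by simp
  qed
  define x where "x = - ln (1 / 2 + d)"
  define y where "y = - ln (1 / 2 - d)"
  have q: "exp (- x) = 1 / 2 + d" "exp (- y) = 1 / 2 - d"
    using \<open>0 < d\<close> \<open>d < 1 / 2\<close> by (auto simp: x_def y_def)
  have "x \<ge> 0" "x < y" "y \<ge> 0" using \<open>0 < d\<close> \<open>d < 1 / 2\<close> by (auto simp: x_def y_def)
  define \<delta> where "\<delta> = (y - x) / 2"
  have prod: "exp (- x) * exp (- y) = m\<^sup>2"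
  proof -
    have "(1 / 2 + d) * (1 / 2 - d) = 1 / 4 - d * d" by (simp add: algebra_simps)
    then show ?thesis unfolding q d2(1) by linarith
  qed
  have compl: "1 - exp (- x) = exp (- y)" "1 - exp (- y) = exp (- x)" by (simp_all add: q)
  have y2: "y = x + 2 * \<delta>" by (simp add: \<delta>_def diff_divide_distrib)
  have "exp (- (\<delta> + x)) ^ 2 = exp (2 * (- (\<delta> + x)))" by (rule exp_double[symmetric])
  also have "2 * (- (\<delta> + x)) = - x + - y" using y2 by simp
  also have "exp (- x + - y) = exp (- x) * exp (- y)" by (rule exp_add)
  also have "\<dots> = m\<^sup>2" by (rule prod)
  finally have qm: "exp (- (\<delta> + x)) = m" by (rule power2_eq_imp_eq) (use m in auto)
  define K where "K = A / m\<^sup>2"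
  have "K > 0" "\<delta> > 0" using assms m \<open>x < y\<close> by (auto simp: K_def \<delta>_def)
  define a where "a k = F (K * one_sided_exp2 (\<delta> * of_int k + x))" for k :: int
  have "totally_nonneg a" unfolding a_def using \<open>K > 0\<close> \<open>\<delta> > 0\<close> by (intro tn) auto
  from totally_nonneg_midpoint[OF this, of 0 1] have "a 0 * a 2 \<le> (a 1)\<^sup>2" by simp
  moreover have "a 0 = F A"
  proof -
    have "one_sided_exp2 x = m\<^sup>2" using \<open>x \<ge> 0\<close> prod by (simp add: one_sided_exp2_def compl)
    then show ?thesis using m by (simp add: a_def K_def)
  qed
  moreover have "a 2 = F A"
  proof -
    have "\<delta> * 2 + x = y" using y2 by linarith
    moreover have "one_sided_exp2 y = m\<^sup>2" using \<open>y \<ge> 0\<close> prod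
      by (simp add: one_sided_exp2_def compl mult.commute)
    ultimately show ?thesis using m by (simp add: a_def K_def)
  qed
  moreover have "a 1 = F C"
  proof -
    have "one_sided_exp2 (\<delta> + x) = m * (1 - m)"
      using \<open>x \<ge> 0\<close> \<open>\<delta> > 0\<close> unfolding one_sided_exp2_def qm by simp
    moreover have "K * (m * (1 - m)) = C"
    proof -
      have "A + C > 0" using assms by simp
      then have "1 - m = C / (A + C)" by (simp add: m_def field_simps)
      moreover have "K * m = A / m" using m by (simp add: K_def power2_eq_square)
      then have "K * m = A + C" using assms by (simp add: m_def)
      ultimately have "(K * m) * (1 - m) = C" using \<open>A + C > 0\<close> by simp
      then show ?thesis by (simp only: mult.assoc)
    qed
    ultimately show ?thesis by (simp add: a_def)
  qed
  ultimately have "(F A)\<^sup>2 \<le> (F C)\<^sup>2" by (simp add: power2_eq_square)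
  then show ?thesis by (rule power2_le_imp_le) (use F_nonneg[of C] assms in auto)
qed auto

text \<open>By monotonicity a zero of \<open>F\<close> makes it vanish up to a threshold
  \<open>u\<close> and positive beyond. Composed with a truncated exponential, such an
  \<open>F\<close> has bounded support of positive length.\<close>

lemma F_pos:
  assumes "c > 0" "F c > 0" "x > 0"
  shows "F x > 0"
proof (rule ccontr)
  assume "\<not> ?thesis"
  with F_nonneg[OF assms(3)] have "F x = 0" by simp
  define Z where "Z = {z. z > 0 \<and> F z = 0}"
  have xZ: "x \<in> Z" using \<open>F x = 0\<close> assms by (simp add: Z_def)
  have Zc: "z \<le> c" if "z \<in> Z" for z
    using F_mono[of c z] assms that by (force simp: Z_def)
  have bdd: "bdd_above Z" using Zc by (auto simp: bdd_above_def)
  define u where "u = Sup Z"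
  have u: "0 < u" "u \<le> c"
    using cSup_upper[OF xZ bdd] assms(3) cSup_least[of Z c] Zc xZ by (auto simp: u_def)
  \<comment> \<open>The point where \<open>2 * c * exp (- x)\<close> falls to \<open>u\<close>;
    since \<open>u \<le> c\<close>, the factor 2 makes it positive.\<close>
  define b where "b = ln (2 * c / u)"
  have exp_lt: "2 * c * exp (- x) < u \<longleftrightarrow> b < x" "u < 2 * c * exp (- x) \<longleftrightarrow> x < b" for x
  proof -
    have "2 * c / u = exp b" using u assms by (simp add: b_def)
    then have "2 * c = u * exp b" using u by (simp add: field_simps)
    then have *: "2 * c * exp (- x) = u * exp (b - x)" by (simp add: exp_diff exp_minus divide_inverse)
    have "u * exp (b - x) < u * exp 0 \<longleftrightarrow> b < x" "u * exp 0 < u * exp (b - x) \<longleftrightarrow> x < b"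
      using u unfolding mult_less_cancel_left_pos[OF u(1)] exp_less_cancel_iff by auto
    then show "2 * c * exp (- x) < u \<longleftrightarrow> b < x" "u < 2 * c * exp (- x) \<longleftrightarrow> x < b"
      unfolding * by auto
  qed
  show False
  proof (rule totally_nonneg_grids_no_bounded_support[of 0 b "\<lambda>x. F (2 * c * one_sided_exp x)"])
    show "0 < b" using exp_lt(2)[of 0] u assms by simp
  next
    fix x assume x: "0 < x" "x < b"
    then have "2 * c * exp (- x) > u" by (simp add: exp_lt)
    then have "2 * c * exp (- x) \<notin> Z" using cSup_upper[OF _ bdd] by (force simp: u_def)
    then show "F (2 * c * one_sided_exp x) > 0"
      using F_nonneg[of "2 * c * exp (- x)"] assms x by (auto simp: Z_def one_sided_exp_def less_le)
  next
    fix x assume "x < 0 \<or> b < x"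
    then show "F (2 * c * one_sided_exp x) = 0"
    proof
      assume "b < x"
      then have "2 * c * exp (- x) < Sup Z" by (simp add: exp_lt u_def[symmetric])
      moreover have "Z \<noteq> {}" using xZ by auto
      ultimately have "\<exists>z\<in>Z. 2 * c * exp (- x) < z" by (intro less_cSupD)
      then obtain z where z: "z > 0" "F z = 0" "2 * c * exp (- x) < z" by (auto simp: Z_def)
      have "F (2 * c * exp (- x)) \<le> F z"
        by (rule F_mono) (use assms z in auto)
      then have "F (2 * c * exp (- x)) \<le> 0" using z by simp
      then show ?thesis using F_nonneg[of "2 * c * exp (- x)"] assms F0
        by (auto simp: one_sided_exp_def)
    qed (simp add: one_sided_exp_def F0)
  next
    show "totally_nonneg (\<lambda>k::int. F (2 * c * one_sided_exp (h * of_int k + s)))" if "h > 0" for h s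
      using that assms by (intro tn) auto
  qed
qed

text \<open>The \<open>3 \<times> 3\<close> minor of the truncated exponential with rows \<open>0, 1, N\<close> and columns
  \<open>- N, 0, 1\<close> straddles the jump at the origin twice; as the mesh tends to \<open>0\<close> it gives the
  inequality opposite to log-concavity.\<close>

lemma F_geometric_midpoint:
  assumes pos: "\<And>x. x > 0 \<Longrightarrow> F x > 0" and "c > 0" "s > 0"
  shows "(F (c * exp (- s)))\<^sup>2 = F c * F (c * exp (- 2 * s))"
proof -
  define P Q R where "P = F (c * exp (- s))" and "Q = F (c * exp (- 2 * s))" and "R = F c"
  have PQR: "P > 0" "Q > 0" "R > 0" using pos \<open>c > 0\<close> by (auto simp: P_def Q_def R_def)
  define b where "b h k = F (c * one_sided_exp (h * of_int k + 0))" for h and k :: int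
  have b: "b h k = F (c * exp (- h * of_int k))" if "k \<ge> 0" "h > 0" for h k
  proof -
    have "0 \<le> h * real_of_int k" using that by simp
    then show ?thesis by (simp add: b_def one_sided_exp_def not_less)
  qed
  have bneg: "b h k = 0" if "k < 0" "h > 0" for h k
    using that by (simp add: b_def one_sided_exp_def mult_pos_neg F0)
  have btn: "totally_nonneg (b h)" if "h > 0" for h
    unfolding b_def using that \<open>c > 0\<close> by (intro tn) auto
  have bpos: "b h k > 0" if "k \<ge> 0" "h > 0" for h k
    using that pos \<open>c > 0\<close> by (simp add: b)
  have "b s 0 * b s 2 \<le> (b s 1)\<^sup>2"
    using totally_nonneg_midpoint[OF btn[OF \<open>s > 0\<close>], of 0 1] by simp
  then have le: "R * Q \<le> P\<^sup>2" using \<open>s > 0\<close> by (simp add: b P_def Q_def R_def mult.commute)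
  have main: "R * P\<^sup>2 + R * P\<^sup>2 * root n (Q / P) \<le> R * P\<^sup>2 / root n (Q / P) + R\<^sup>2 * Q" if n: "n \<ge> 2" for n
  proof -
    define h where "h = s / real n"
    have h: "h > 0" "h * real n = s" using n \<open>s > 0\<close> by (auto simp: h_def)
    define \<beta> where "\<beta> = b h"
    have \<beta>tn: "totally_nonneg \<beta>" using btn h by (simp add: \<beta>_def)
    have \<beta>pos: "\<beta> k > 0" if "k \<ge> 0" for k using bpos that h by (simp add: \<beta>_def)
    have \<beta>n: "\<beta> (int n) = P" "\<beta> (2 * int n) = Q" "\<beta> 0 = R" "\<beta> (-1) = 0"
      using h by (auto simp: \<beta>_def b bneg P_def Q_def R_def mult.left_commute)
    \<comment> \<open>\<open>r\<close> tends to 1 as \<open>n\<close> grows. Log-concavity gives at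
      least \<open>P * r\<close> one step to the right of the value \<open>P\<close> and at most
      \<open>P / r\<close> one step to the left; this stands in for continuity of \<open>F\<close>,
      which is not yet known.\<close>
    define r where "r = root n (Q / P)"
    have r: "r > 0" using PQR n by (simp add: r_def real_root_gt_zero)
    have v: "P * r \<le> \<beta> (int n + 1)"
      using log_concave_ratio_root[OF \<beta>tn, of "int n" n] \<beta>pos n PQR \<beta>n
      by (simp add: r_def field_simps)
    have "\<beta> (int n - 1) * \<beta> (int n + 1) \<le> P\<^sup>2"
      using totally_nonneg_midpoint[OF \<beta>tn, of "int n - 1" "int n"] \<beta>n by (simp add: algebra_simps)
    moreover have u0: "\<beta> (int n - 1) > 0" using \<beta>pos n by simp
    ultimately have "\<beta> (int n - 1) * (P * r) \<le> P\<^sup>2"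
      using v by (meson less_imp_le mult_left_mono order_trans)
    then have u: "\<beta> (int n - 1) \<le> P / r"
      using PQR r by (simp add: power2_eq_square field_simps)
    have "h * (real n - 1) \<le> s" unfolding h(2)[symmetric] using h(1) by simp
    then have u': "P \<le> \<beta> (int n - 1)"
      using n h \<open>c > 0\<close> unfolding \<beta>_def P_def by (subst b) (auto intro!: F_mono)
    have b1: "\<beta> 1 \<le> R"
      using h \<open>c > 0\<close> unfolding \<beta>_def R_def by (subst b) (auto intro!: F_mono)
    define x where "x i = (if i = 0 then 0 else if i = 1 then 1 else int n)" for i :: nat
    define y where "y i = (if i = 0 then - int n else if i = 1 then 0 else 1)" for i :: nat
    have "strict_mono_on {..<3} x" "strict_mono_on {..<3} y"
      using n by (auto simp: strict_mono_on_def x_def y_def)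
    from totally_nonnegD[OF \<beta>tn this]
    have "0 \<le> P * (\<beta> 1 * \<beta> (int n - 1) - R * P) - \<beta> (int n + 1) * (R * \<beta> (int n - 1)) + Q * (R * R)"
      by (simp add: ddet_3 x_def y_def \<beta>n add.commute)
    moreover have "P * (\<beta> 1 * \<beta> (int n - 1)) \<le> P * (R * (P / r))"
      using b1 u u0 PQR by (intro mult_left_mono mult_mono) auto
    moreover have "(P * r) * (R * P) \<le> \<beta> (int n + 1) * (R * \<beta> (int n - 1))"
      using v u' PQR r \<beta>pos[of "int n + 1"] by (intro mult_mono mult_left_mono) auto
    ultimately show ?thesis
      by (simp add: r_def[symmetric] power2_eq_square algebra_simps)
  qed
  have root: "(\<lambda>n. root n (Q / P)) \<longlonglongrightarrow> 1"
    using PQR by (intro LIMSEQ_root_const) simp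
  have "R * P\<^sup>2 + R * P\<^sup>2 * 1 \<le> R * P\<^sup>2 / 1 + R\<^sup>2 * Q"
  proof (rule tendsto_le[OF sequentially_bot])
    show "(\<lambda>n. R * P\<^sup>2 / root n (Q / P) + R\<^sup>2 * Q) \<longlonglongrightarrow> R * P\<^sup>2 / 1 + R\<^sup>2 * Q"
      "(\<lambda>n. R * P\<^sup>2 + R * P\<^sup>2 * root n (Q / P)) \<longlonglongrightarrow> R * P\<^sup>2 + R * P\<^sup>2 * 1"
      by (intro tendsto_intros root; simp)+
    show "\<forall>\<^sub>F n in sequentially. R * P\<^sup>2 + R * P\<^sup>2 * root n (Q / P) \<le> R * P\<^sup>2 / root n (Q / P) + R\<^sup>2 * Q"
      using eventually_ge_at_top[of 2] by eventually_elim (rule main)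
  qed
  then have "R * P\<^sup>2 \<le> R * (R * Q)" by (simp add: power2_eq_square algebra_simps)
  then have "P\<^sup>2 \<le> R * Q" using PQR by simp
  with le show ?thesis by (simp add: P_def Q_def R_def)
qed

text \<open>In logarithmic coordinates the geometric midpoint identity is Jensen's functional
  equation; subtracting the value at 0 gives a monotone additive function.\<close>

lemma F_power:
  assumes pos: "\<And>x. x > 0 \<Longrightarrow> F x > 0"
  obtains C \<alpha> where "C > 0" "\<alpha> \<ge> 0" "\<And>x. x > 0 \<Longrightarrow> F x = C * x powr \<alpha>"
proof -
  define g where "g u = ln (F (exp u))" for u
  have mid': "2 * g ((u + v) / 2) = g u + g v" if "v < u" for u v
  proof -
    have *: "exp u * exp (- ((u - v) / 2)) = exp ((u + v) / 2)" "exp u * exp (- 2 * ((u - v) / 2)) = exp v"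
      by (simp_all add: exp_add[symmetric] field_simps)
    have "(F (exp ((u + v) / 2)))\<^sup>2 = F (exp u) * F (exp v)"
      using F_geometric_midpoint[OF pos, of "exp u" "(u - v) / 2"] that unfolding * by simp
    then have "ln ((F (exp ((u + v) / 2)))\<^sup>2) = ln (F (exp u) * F (exp v))" by simp
    then show ?thesis
      using pos[of "exp u"] pos[of "exp v"] by (simp add: g_def ln_mult ln_realpow)
  qed
  have mid: "2 * g ((u + v) / 2) = g u + g v" for u v
    using mid'[of u v] mid'[of v u] by (cases u v rule: linorder_cases) (auto simp: add.commute)
  define A where "A u = g u - g 0" for u
  have "A (u + v) = A u + A v" for u v
    using mid[of "u + v" 0] mid[of u v] by (simp add: A_def)
  moreover have monoA: "mono A"
    using pos by (intro monoI) (auto simp: A_def g_def intro!: F_mono)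
  ultimately have lin: "A u = A 1 * u" for u by (rule additive_mono_imp_linear)
  have "A 1 \<ge> 0" using monoD[OF monoA, of 0 1] by (simp add: A_def)
  moreover have "F x = exp (g 0) * x powr A 1" if "x > 0" for x
  proof -
    have "ln (F x) = g 0 + A 1 * ln x" using lin[of "ln x"] that by (simp add: A_def g_def)
    then have "F x = exp (g 0 + A 1 * ln x)" using pos[OF that] by (metis exp_ln)
    then show ?thesis using that by (simp add: exp_add powr_def)
  qed
  ultimately show thesis using that[of "exp (g 0)" "A 1"] by simp
qed


lemma test_preserver_classification:
  "(\<forall>x>0. F x = 0) \<or> (\<exists>c>0. (\<forall>x>0. F x = c * x) \<or> (\<forall>x>0. F x = c))"
proof (cases "\<forall>x>0. F x = 0")
  case False
  then obtain c where c: "c > 0" "F c > 0" using F_nonneg by (metis less_le)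
  have pos: "F x > 0" if "x > 0" for x using F_pos[OF c that] .
  obtain C \<alpha> where C: "C > 0" "\<alpha> \<ge> 0" "\<And>x. x > 0 \<Longrightarrow> F x = C * x powr \<alpha>"
    using F_power[OF pos] by blast
  \<comment> \<open>The tilt cancels the factor \<open>q powr \<alpha>\<close> at
    \<open>q = 2 ^ (- k)\<close> and leaves the pure power of the bracket.\<close>
  have untilt: "consecutive_rows_tn (\<lambda>k. exp (\<alpha> * ln 2 * of_int k) / C * F (1 * \<phi> (ln 2 * of_int k + 0)))"
    if "\<phi> \<in> {one_sided_exp, one_sided_exp2, one_sided_exp3}" for \<phi>
  proof -
    have "totally_nonneg (\<lambda>k. F (1 * \<phi> (ln 2 * of_int k + 0)))" using that by (intro tn) auto
    then have "totally_nonneg (\<lambda>k. exp (\<alpha> * ln 2 * of_int k) / C * F (1 * \<phi> (ln 2 * of_int k + 0)))"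
    proof (rule totally_nonneg_factor)
      fix k l :: int
      have "exp (\<alpha> * ln 2 * of_int (k - l)) = exp (\<alpha> * ln 2 * of_int k) * exp (- (\<alpha> * ln 2 * of_int l))"
        by (simp add: exp_add[symmetric] algebra_simps)
      then show "exp (\<alpha> * ln 2 * of_int (k - l)) / C * F (1 * \<phi> (ln 2 * of_int (k - l) + 0)) =
          exp (\<alpha> * ln 2 * of_int k) / C * exp (- (\<alpha> * ln 2 * of_int l)) * F (1 * \<phi> (ln 2 * of_int (k - l) + 0))"
        by simp
    qed (use C(1) in auto)
    then show ?thesis by (rule totally_nonneg_imp_consecutive_rows_tn)
  qed
  have q: "exp (- (ln 2 * real n)) = (1 / 2) ^ n" for n
  proof -
    have "exp (- (ln 2 * real n)) = exp (real n * (- ln 2))" by (simp add: mult.commute)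
    also have "\<dots> = exp (- ln 2) ^ n" by (rule exp_of_nat_mult)
    also have "exp (- ln 2) = (1 / 2 :: real)" by (simp add: exp_minus)
    finally show ?thesis .
  qed
  have nn: "\<not> ln 2 * real n < 0" for n by (simp add: not_less)
  have scale: "exp (\<alpha> * ln 2 * of_int (int n)) / C * F ((1 / 2) ^ n * u) = u powr \<alpha>" if "u > 0" for n u
  proof -
    have "exp (\<alpha> * ln 2 * real n) * ((1 / 2) ^ n) powr \<alpha> = 1"
      unfolding q[symmetric] by (simp add: powr_def exp_add[symmetric])
    then show ?thesis using that C(1) by (simp add: C(3) powr_mult)
  qed
  have q1: "(1 / 2) ^ n < (1 :: real)" if "n > 0" for n
    using that by (simp add: power_less_one_iff)
  have "\<not> (0 < \<alpha> \<and> \<alpha> < 1)"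
  proof
    assume \<alpha>: "0 < \<alpha> \<and> \<alpha> < 1"
    show False
    proof (rule no_power_below_one[OF untilt[of one_sided_exp2]])
      show "\<forall>\<^sub>F n in sequentially. exp (\<alpha> * ln 2 * of_int (int n)) / C *
          F (1 * one_sided_exp2 (ln 2 * of_int (int n) + 0)) = (1 - (1 / 2) ^ n) powr \<alpha>"
        using eventually_gt_at_top[of 0]
      proof eventually_elim
        case (elim n)
        have "one_sided_exp2 (ln 2 * real n) = (1 / 2) ^ n * (1 - (1 / 2) ^ n)"
          unfolding one_sided_exp2_def q by (simp add: nn)
        then show ?case using scale[of "1 - (1 / 2) ^ n" n] q1[OF elim] by simp
      qed
    qed (use \<alpha> in auto)
  qed
  moreover have "\<not> 1 < \<alpha>"
  proof
    assume \<alpha>: "1 < \<alpha>"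
    show False
    proof (rule no_power_above_one[OF untilt[of one_sided_exp3]])
      show "\<forall>\<^sub>F n in sequentially. exp (\<alpha> * ln 2 * of_int (int n)) / C *
          F (1 * one_sided_exp3 (ln 2 * of_int (int n) + 0)) =
          (1 - 3 * ((1 / 2) ^ n) ^ 2 + 2 * ((1 / 2) ^ n) ^ 3) powr \<alpha>"
        using eventually_gt_at_top[of 0]
      proof eventually_elim
        case (elim n)
        define t :: real where "t = (1 / 2) ^ n"
        have "one_sided_exp3 (ln 2 * real n) = t * (1 - 3 * t ^ 2 + 2 * t ^ 3)"
          unfolding one_sided_exp3_def q t_def by (simp add: nn)
        moreover have "1 - 3 * t ^ 2 + 2 * t ^ 3 > 0"
        proof -
          have "1 - 3 * t ^ 2 + 2 * t ^ 3 = (1 - t) ^ 2 * (1 + 2 * t)"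
            by (simp add: power2_eq_square power3_eq_cube algebra_simps)
          moreover have "0 < t" "t < 1" using q1[OF elim] by (auto simp: t_def)
          ultimately show ?thesis by (simp add: add_pos_pos)
        qed
        ultimately show ?case using scale[of "1 - 3 * t ^ 2 + 2 * t ^ 3" n] by (simp add: t_def[symmetric])
      qed
    qed (use \<alpha> in auto)
  qed
  ultimately have "\<alpha> = 0 \<or> \<alpha> = 1" using C(2) by linarith
  then show ?thesis using C by auto
qed blast

end


section \<open>Preservers of one-sided classes\<close>

text \<open>It serves twice: left of the origin, where the test function vanishes, it gives
  \<open>F 0 = 0\<close>, and right of it it excludes \<open>F\<close> constant on
  \<open>x > 0\<close>.\<close>

lemma integrable_const_on_long_intervals:
  fixes f :: "real \<Rightarrow> real"
  assumes f: "integrable lebesgue f"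
    and c: "\<And>n::nat. \<exists>a. \<forall>x\<in>{a..a + real n}. f x = c"
  shows "c = 0"
proof (rule ccontr)
  assume "c \<noteq> 0"
  have "\<bar>c\<bar> * real n \<le> (LINT x|lebesgue. \<bar>f x\<bar>)" for n
  proof -
    obtain a where a: "\<forall>x\<in>{a..a + real n}. f x = c" using c by blast
    have "(LINT x|lebesgue. \<bar>c\<bar> * indicator {a..a + real n} x) \<le> (LINT x|lebesgue. \<bar>f x\<bar>)"
      by (rule integral_mono) (use f a in \<open>auto split: split_indicator\<close>)
    then show ?thesis by simp
  qed
  then have "real n \<le> (LINT x|lebesgue. \<bar>f x\<bar>) / \<bar>c\<bar>" for n
    using \<open>c \<noteq> 0\<close> by (simp add: field_simps)
  moreover obtain n where "(LINT x|lebesgue. \<bar>f x\<bar>) / \<bar>c\<bar> < real n" using reals_Archimedean2 by blast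
  ultimately show False by (meson not_le)
qed

lemma totally_nonneg_zero: "totally_nonneg (\<lambda>_::'a::linordered_idom. 0)"
  using totally_nonneg_cmult[OF totally_nonneg_indicator_singleton, of 0] by simp

text \<open>The inequality for minors of size 2 makes the support order-convex. If unbounded above
  it is upward closed, if unbounded below it becomes so after reflection, and a bounded one has at
  most one point.\<close>

lemma totally_nonneg_indicator_support:
  fixes \<Lambda> :: "real \<Rightarrow> real"
  assumes tn: "totally_nonneg \<Lambda>"
  shows "totally_nonneg (indicator {x. \<Lambda> x > 0} :: real \<Rightarrow> real)"
proof -
  define S where "S = {x. \<Lambda> x > 0}"
  have nn: "\<Lambda> x \<ge> 0" for x by (rule totally_nonneg_nonneg[OF tn])
  have conv: "y \<in> S" if "x \<in> S" "z \<in> S" "x \<le> y" "y \<le> z" for x y z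
  proof (cases "x = y \<or> y = z")
    case False
    then have "\<Lambda> x * \<Lambda> z \<le> \<Lambda> y * \<Lambda> (x + z - y)"
      using that by (intro totally_nonneg_2x2[OF tn]) auto
    moreover have "\<Lambda> x * \<Lambda> z > 0" using that by (simp add: S_def)
    ultimately have "\<Lambda> y \<noteq> 0" by auto
    then show ?thesis using nn[of y] by (simp add: S_def less_le)
  qed (use that in auto)
  consider "\<not> bdd_above S" | "\<not> bdd_below S" | "bdd_above S" "bdd_below S" by blast
  then have "totally_nonneg (indicator S :: real \<Rightarrow> real)"
  proof cases
    case 1
    show ?thesis
    proof (rule totally_nonneg_indicator_upper)
      fix x y assume "x \<in> S" "x \<le> y"
      moreover obtain z where "z \<in> S" "y < z" using 1 by (auto simp: bdd_above_def not_le)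
      ultimately show "y \<in> S" by (intro conv[of x z y]) auto
    qed
  next
    case 2
    have "totally_nonneg (indicator {x. - x \<in> S} :: real \<Rightarrow> real)"
    proof (rule totally_nonneg_indicator_upper)
      fix x y assume "x \<in> {x. - x \<in> S}" "x \<le> y"
      moreover obtain z where "z \<in> S" "z < - y" using 2 by (auto simp: bdd_below_def not_le)
      ultimately show "y \<in> {x. - x \<in> S}" using conv[of z "- x" "- y"] by auto
    qed
    from totally_nonneg_reflect[OF this] show ?thesis by (simp add: indicator_def[abs_def])
  next
    case 3
    show ?thesis
    proof (cases "\<exists>u v. u \<in> S \<and> v \<in> S \<and> u < v")
      case True
      then obtain u v where uv: "u \<in> S" "v \<in> S" "u < v" by blast
      have False
      proof (rule totally_nonneg_grids_no_bounded_support[of "Inf S" "Sup S" \<Lambda>])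
        show "Inf S < Sup S"
          using cInf_lower[OF uv(1) 3(2)] cSup_upper[OF uv(2) 3(1)] uv(3) by linarith
      next
        fix x assume "Inf S < x" "x < Sup S"
        then obtain y z where "y \<in> S" "y < x" "z \<in> S" "x < z"
          using cInf_lessD[of S] less_cSupD[of S] uv(1) by blast
        then have "x \<in> S" by (intro conv[of y z x]) auto
        then show "\<Lambda> x > 0" by (simp add: S_def)
      next
        fix x assume "x < Inf S \<or> Sup S < x"
        then have "x \<notin> S" using cInf_lower[OF _ 3(2), of x] cSup_upper[OF _ 3(1), of x] by force
        then show "\<Lambda> x = 0" using nn[of x] by (simp add: S_def)
      qed (rule totally_nonneg_sample[OF totally_nonneg_affine[OF tn]])
      then show ?thesis ..
    next
      case False
      then have "x = y" if "x \<in> S" "y \<in> S" for x y using that by (cases x y rule: linorder_cases) auto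
      then have "S = {} \<or> (\<exists>d. S = {d})" by blast
      then show ?thesis
        using totally_nonneg_zero totally_nonneg_indicator_singleton by (auto simp: indicator_def[abs_def])
    qed
  qed
  then show ?thesis by (simp add: S_def)
qed

lemma one_sided_function_comp:
  assumes "F 0 = 0" "one_sided_function \<Lambda>"
  shows "one_sided_function (F \<circ> \<Lambda>)"
proof -
  obtain x0 where "(\<forall>x<x0. \<Lambda> x = 0) \<or> (\<forall>x>x0. \<Lambda> x = 0)"
    using assms(2) unfolding one_sided_function_def by blast
  then have "(\<forall>x<x0. (F \<circ> \<Lambda>) x = 0) \<or> (\<forall>x>x0. (F \<circ> \<Lambda>) x = 0)" using assms(1) by auto
  then show ?thesis unfolding one_sided_function_def by blast
qed

lemma one_sided_sequence_comp:
  assumes "F 0 = 0" "one_sided_sequence \<Lambda>"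
  shows "one_sided_sequence (F \<circ> \<Lambda>)"
proof -
  obtain x0 :: real where "(\<forall>k. of_int k < x0 \<longrightarrow> \<Lambda> k = 0) \<or> (\<forall>k. of_int k > x0 \<longrightarrow> \<Lambda> k = 0)"
    using assms(2) unfolding one_sided_sequence_def by blast
  then have "(\<forall>k. of_int k < x0 \<longrightarrow> (F \<circ> \<Lambda>) k = 0) \<or> (\<forall>k. of_int k > x0 \<longrightarrow> (F \<circ> \<Lambda>) k = 0)"
    using assms(1) by auto
  then show ?thesis unfolding one_sided_sequence_def by blast
qed

theorem theorem5p5:
  fixes F :: "real \<Rightarrow> real"
  assumes "F \<in> {0..} \<rightarrow> {0..}"
  shows "(comp_preserves F {\<Lambda>. polya_frequency_function \<Lambda> \<and> one_sided_function \<Lambda>} \<longleftrightarrow>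
            (\<exists>c>0. \<forall>x\<ge>0. F x = c * x)) \<and>
         (comp_preserves F {\<Lambda>. polya_frequency_sequence \<Lambda> \<and> one_sided_sequence \<Lambda>} \<longleftrightarrow>
            (\<forall>x\<ge>0. F x = 0) \<or> (\<exists>c>0. \<forall>x\<ge>0. F x = c * x)) \<and>
         (comp_preserves F {\<Lambda> :: real \<Rightarrow> real. totally_nonneg \<Lambda> \<and> one_sided_function \<Lambda>} \<longleftrightarrow>
            (\<forall>x\<ge>0. F x = 0) \<or>
            (\<exists>c>0. (\<forall>x\<ge>0. F x = c * x) \<or> (\<forall>x\<ge>0. F x = c * indicator {0<..} x)))"
proof -
  let ?tests = "{one_sided_exp, one_sided_exp2, one_sided_exp3}"
  have test_neg: "\<phi> x = 0" if "\<phi> \<in> ?tests" "x < 0" for \<phi> x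
    using that by (auto simp: one_sided_exp_def one_sided_exp2_def one_sided_exp3_def)
  have test_tn: "totally_nonneg (\<lambda>x. K * \<phi> x)" if "\<phi> \<in> ?tests" "K > 0" for \<phi> K
    using one_sided_test_functions[OF that] by (simp add: polya_frequency_function_def)
  have linear: "F \<circ> \<Lambda> = (\<lambda>x. c * \<Lambda> x)"
    if "\<forall>x\<ge>0. F x = c * x" "totally_nonneg \<Lambda>" for c and \<Lambda> :: "'b::linordered_idom \<Rightarrow> real"
    using that totally_nonneg_nonneg[of \<Lambda>] by (auto simp: fun_eq_iff)
  have classify: "(\<forall>x>0. F x = 0) \<or> (\<exists>c>0. (\<forall>x>0. F x = c * x) \<or> (\<forall>x>0. F x = c))"
    if "F 0 = 0" "\<And>\<phi> K. \<phi> \<in> ?tests \<Longrightarrow> K > 0 \<Longrightarrow> totally_nonneg (\<lambda>x. F (K * \<phi> x))"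
  proof (rule test_preserver_classification[where F = F, OF that(1)])
    fix \<phi> and K h s :: real assume "\<phi> \<in> ?tests" "K > 0" "h > 0"
    then show "totally_nonneg (\<lambda>k::int. F (K * \<phi> (h * of_int k + s)))"
      by (rule totally_nonneg_sample[OF totally_nonneg_affine[OF that(2)]])
  qed
  have 1: "comp_preserves F {\<Lambda>. polya_frequency_function \<Lambda> \<and> one_sided_function \<Lambda>} \<longleftrightarrow>
      (\<exists>c>0. \<forall>x\<ge>0. F x = c * x)" (is "?P \<longleftrightarrow> ?Q")
  proof
    assume P: ?P
    have test: "polya_frequency_function (\<lambda>x. F (K * \<phi> x))" if "\<phi> \<in> ?tests" "K > 0" for \<phi> K
      using P one_sided_test_functions[OF that] by (simp add: comp_preserves_def o_def)
    have f: "polya_frequency_function (\<lambda>x. F (1 * one_sided_exp x))" by (rule test) auto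
    then have int: "integrable lebesgue (\<lambda>x. F (1 * one_sided_exp x))"
      by (simp add: polya_frequency_function_def)
    have F0: "F 0 = 0"
    proof (rule integrable_const_on_long_intervals[OF int])
      show "\<exists>a. \<forall>x\<in>{a..a + real n}. F (1 * one_sided_exp x) = F 0" for n
        by (rule exI[of _ "- real n - 1"]) (auto simp: one_sided_exp_def)
    qed
    have "totally_nonneg (\<lambda>x. F (K * \<phi> x))" if "\<phi> \<in> ?tests" "K > 0" for \<phi> K
      using test[OF that] by (simp add: polya_frequency_function_def)
    from classify[OF F0 this] consider "\<forall>x>0. F x = 0" | c where "c > 0" "\<forall>x>0. F x = c * x"
      | c where "c > 0" "\<forall>x>0. F x = c" by blast
    then show ?Q
    proof cases
      case 1
      then have "F (1 * one_sided_exp x) = 0" for x using F0 by (simp add: one_sided_exp_def)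
      then show ?thesis using f by (simp add: polya_frequency_function_def)
    next
      case (2 c)
      then have "\<forall>x\<ge>0. F x = c * x" using F0 by (auto simp: le_less)
      then show ?thesis using 2(1) by blast
    next
      case (3 c)
      have "c = 0"
      proof (rule integrable_const_on_long_intervals[OF int])
        show "\<exists>a. \<forall>x\<in>{a..a + real n}. F (1 * one_sided_exp x) = c" for n
          by (rule exI[of _ 0]) (use 3 in \<open>auto simp: one_sided_exp_def\<close>)
      qed
      with 3(1) show ?thesis by simp
    qed
  next
    assume ?Q
    then obtain c where c: "c > 0" "\<forall>x\<ge>0. F x = c * x" by blast
    show ?P
      unfolding comp_preserves_def
    proof (intro ballI CollectI)
      fix \<Lambda> assume "\<Lambda> \<in> {\<Lambda>. polya_frequency_function \<Lambda> \<and> one_sided_function \<Lambda>}"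
      then have \<Lambda>: "polya_frequency_function \<Lambda>" "one_sided_function \<Lambda>" by auto
      then have tn: "totally_nonneg \<Lambda>" by (simp add: polya_frequency_function_def)
      have "polya_frequency_function (F \<circ> \<Lambda>)"
        using \<Lambda>(1) c(1) totally_nonneg_cmult[OF tn, of c]
        unfolding linear[OF c(2) tn] polya_frequency_function_def by simp
      moreover have "F 0 = 0" using c(2) by simp
      ultimately show "polya_frequency_function (F \<circ> \<Lambda>) \<and> one_sided_function (F \<circ> \<Lambda>)"
        using one_sided_function_comp[OF _ \<Lambda>(2)] by simp
    qed
  qed
  have 2: "comp_preserves F {\<Lambda>. polya_frequency_sequence \<Lambda> \<and> one_sided_sequence \<Lambda>} \<longleftrightarrow>
      (\<forall>x\<ge>0. F x = 0) \<or> (\<exists>c>0. \<forall>x\<ge>0. F x = c * x)" (is "?P \<longleftrightarrow> ?Q")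
  proof
    assume P: ?P
    have preserve: "totally_nonneg (\<lambda>k. F (a k)) \<and> one_sided_sequence (\<lambda>k. F (a k))"
      if "totally_nonneg a" "one_sided_sequence a" for a
      using P that by (simp add: comp_preserves_def polya_frequency_sequence_def o_def)
    \<comment> \<open>The zero sequence belongs to the class; its image is the constant
      \<open>F 0\<close>, which is one-sided only if it is 0.\<close>
    have "one_sided_sequence (\<lambda>k. F 0)"
      using preserve[OF totally_nonneg_zero] by (simp add: one_sided_sequence_def)
    then obtain x0 :: real where x0: "(\<forall>k. of_int k < x0 \<longrightarrow> F 0 = 0) \<or> (\<forall>k. of_int k > x0 \<longrightarrow> F 0 = 0)"
      unfolding one_sided_sequence_def by blast
    obtain k l where "of_int k < x0" "x0 < of_int l"
      using ex_of_int_less[of x0] ex_less_of_int[of x0] by blast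
    with x0 have F0: "F 0 = 0" by blast
    have "totally_nonneg (\<lambda>k::int. F (K * \<phi> (h * of_int k + s)))"
      if "\<phi> \<in> ?tests" "K > 0" "h > 0" for \<phi> K h s
    proof -
      have "totally_nonneg (\<lambda>k::int. K * \<phi> (h * of_int k + s))"
        by (rule totally_nonneg_sample[OF totally_nonneg_affine[OF test_tn[OF that(1,2)] that(3)]])
      moreover have "\<phi> (h * of_int k + s) = 0" if "of_int k < - s / h" for k
      proof (rule test_neg[OF \<open>\<phi> \<in> ?tests\<close>])
        have "real_of_int k * h < - s" using that pos_less_divide_eq[OF \<open>h > 0\<close>] by blast
        then show "h * of_int k + s < 0" by (simp add: mult.commute)
      qed
      then have "one_sided_sequence (\<lambda>k::int. K * \<phi> (h * of_int k + s))"
        unfolding one_sided_sequence_def by (intro exI[of _ "- s / h"] disjI1) auto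
      ultimately show ?thesis using preserve by blast
    qed
    from test_preserver_classification[where F = F, OF F0 this]
    consider "\<forall>x>0. F x = 0" | c where "c > 0" "\<forall>x>0. F x = c * x"
      | c where "c > 0" "\<forall>x>0. F x = c" by blast
    then show ?Q
    proof cases
      case 1
      then show ?thesis using F0 by (auto simp: le_less)
    next
      case (2 c)
      then have "\<forall>x\<ge>0. F x = c * x" using F0 by (auto simp: le_less)
      then show ?thesis using 2(1) by blast
    next
      case (3 c)
      \<comment> \<open>The coefficients \<open>1, 2, 1\<close> of \<open>(1 + t)\<^sup>2\<close>.
        The image \<open>c, c, c\<close> has a tridiagonal minor of size 3 equal to
        \<open>- (c ^ 3)\<close>.\<close>
      define a :: "int \<Rightarrow> real" where
        "a k = (indicator {0} k + indicator {0} (k - 1)) + (indicator {0} (k - 1) + indicator {0} (k - 1 - 1))" for k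
      have "totally_nonneg a"
        unfolding a_def
        by (rule totally_nonneg_add_shift[OF totally_nonneg_add_shift[OF totally_nonneg_indicator_singleton]])
      moreover have "one_sided_sequence a"
        unfolding one_sided_sequence_def a_def by (rule exI[of _ 0]) auto
      ultimately have tn: "totally_nonneg (\<lambda>k. F (a k))" using preserve by blast
      have Fa: "F (a (-1)) = 0" "F (a 0) = c" "F (a 1) = c" "F (a 2) = c" "F (a 3) = 0"
        using 3 F0 by (simp_all add: a_def)
      have "0 \<le> ddet 3 (\<lambda>i j. F (a (int i + 1 - int j)))"
        by (rule totally_nonnegD[OF tn]) (auto simp: strict_mono_on_def)
      also have "\<dots> = - (c * c * c)" by (simp add: ddet_3 Fa)
      finally show ?thesis using 3(1) by (simp add: mult_le_0_iff not_le)
    qed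
  next
    assume Q: ?Q
    have "\<exists>c\<ge>0. \<forall>x\<ge>0. F x = c * x"
    proof (cases "\<forall>x\<ge>0. F x = 0")
      case True
      then show ?thesis by (intro exI[of _ 0]) auto
    next
      case False
      with Q show ?thesis by (blast intro: less_imp_le)
    qed
    then obtain c where c: "c \<ge> 0" "\<forall>x\<ge>0. F x = c * x" by blast
    show ?P
      unfolding comp_preserves_def
    proof (intro ballI CollectI)
      fix \<Lambda> assume "\<Lambda> \<in> {\<Lambda>. polya_frequency_sequence \<Lambda> \<and> one_sided_sequence \<Lambda>}"
      then have \<Lambda>: "totally_nonneg \<Lambda>" "one_sided_sequence \<Lambda>"
        by (auto simp: polya_frequency_sequence_def)
      have "totally_nonneg (F \<circ> \<Lambda>)"
        unfolding linear[OF c(2) \<Lambda>(1)] by (rule totally_nonneg_cmult[OF \<Lambda>(1) c(1)])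
      moreover have "F 0 = 0" using c(2) by simp
      ultimately show "polya_frequency_sequence (F \<circ> \<Lambda>) \<and> one_sided_sequence (F \<circ> \<Lambda>)"
        using one_sided_sequence_comp[OF _ \<Lambda>(2)] by (simp add: polya_frequency_sequence_def)
    qed
  qed
  have 3: "comp_preserves F {\<Lambda> :: real \<Rightarrow> real. totally_nonneg \<Lambda> \<and> one_sided_function \<Lambda>} \<longleftrightarrow>
      (\<forall>x\<ge>0. F x = 0) \<or>
      (\<exists>c>0. (\<forall>x\<ge>0. F x = c * x) \<or> (\<forall>x\<ge>0. F x = c * indicator {0<..} x))" (is "?P \<longleftrightarrow> ?Q")
  proof
    assume P: ?P
    have preserve: "totally_nonneg (\<lambda>x. F (\<Lambda> x)) \<and> one_sided_function (\<lambda>x. F (\<Lambda> x))"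
      if "totally_nonneg \<Lambda>" "one_sided_function \<Lambda>" for \<Lambda>
      using P that by (simp add: comp_preserves_def o_def)
    have "one_sided_function (\<lambda>x. F 0)"
      using preserve[OF totally_nonneg_zero] by (simp add: one_sided_function_def)
    then obtain x0 :: real where x0: "(\<forall>x<x0. F 0 = 0) \<or> (\<forall>x>x0. F 0 = 0)"
      unfolding one_sided_function_def by blast
    have "x0 - 1 < x0" "x0 < x0 + 1" by auto
    with x0 have F0: "F 0 = 0" by blast
    have "totally_nonneg (\<lambda>x. F (K * \<phi> x))" if "\<phi> \<in> ?tests" "K > 0" for \<phi> K
      using preserve[OF test_tn[OF that]] one_sided_test_functions[OF that] by blast
    from classify[OF F0 this] consider "\<forall>x>0. F x = 0" | c where "c > 0" "\<forall>x>0. F x = c * x"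
      | c where "c > 0" "\<forall>x>0. F x = c" by blast
    then show ?Q
    proof cases
      case 1
      then show ?thesis using F0 by (auto simp: le_less)
    next
      case (2 c)
      then have "\<forall>x\<ge>0. F x = c * x" using F0 by (auto simp: le_less)
      then show ?thesis using 2(1) by blast
    next
      case (3 c)
      then have "\<forall>x\<ge>0. F x = c * indicator {0<..} x" using F0 by (auto simp: le_less)
      then show ?thesis using 3(1) by blast
    qed
  next
    assume Q: ?Q
    show ?P
      unfolding comp_preserves_def
    proof (intro ballI CollectI)
      fix \<Lambda> :: "real \<Rightarrow> real" assume "\<Lambda> \<in> {\<Lambda>. totally_nonneg \<Lambda> \<and> one_sided_function \<Lambda>}"
      then have \<Lambda>: "totally_nonneg \<Lambda>" "one_sided_function \<Lambda>" by auto
      have nn: "\<Lambda> x \<ge> 0" for x by (rule totally_nonneg_nonneg[OF \<Lambda>(1)])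
      have "F 0 = 0" using Q by auto
      then have "one_sided_function (F \<circ> \<Lambda>)"
        using \<Lambda>(2) by (rule one_sided_function_comp)
      moreover consider "\<forall>x\<ge>0. F x = 0 * x" | c where "c > 0" "\<forall>x\<ge>0. F x = c * x"
        | c where "c > 0" "\<forall>x\<ge>0. F x = c * indicator {0<..} x"
        using Q unfolding mult_zero_left by blast
      then have "totally_nonneg (F \<circ> \<Lambda>)"
      proof cases
        case 1
        show ?thesis unfolding linear[OF 1 \<Lambda>(1)] by (rule totally_nonneg_cmult[OF \<Lambda>(1)]) simp
      next
        case (2 c)
        show ?thesis unfolding linear[OF 2(2) \<Lambda>(1)]
          by (rule totally_nonneg_cmult[OF \<Lambda>(1) less_imp_le[OF 2(1)]])
      next
        case (3 c)
        have "F \<circ> \<Lambda> = (\<lambda>x. c * indicator {x. \<Lambda> x > 0} x)"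
          using 3 nn by (auto simp: fun_eq_iff split: split_indicator)
        then show ?thesis
          using totally_nonneg_cmult[OF totally_nonneg_indicator_support[OF \<Lambda>(1)], of c] 3(1) by simp
      qed
      ultimately show "totally_nonneg (F \<circ> \<Lambda>) \<and> one_sided_function (F \<circ> \<Lambda>)" by blast
    qed
  qed
  from 1 2 3 show ?thesis by blast
qed

end
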